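(* Let $X$ be a real Banach space, let $G\subset\mathbb{R}^m$ be a subset with $G^{o}\neq\emptyset$ and $|G\setminus G^{o}|=0$, let $f:G\to X$ be a function and let $F:\mathcal{I}_G\to X$ be an additive interval function. Let $h:\mathbb{R}^m\to X$ be defined by $h(t)=f(t)$ if $t\in G$ and $h(t)=0$ if $t\in\mathbb{R}^m\setminus G$. Then the following statements are equivalent: (i) $f$ is Hake-McShane integrable on $G$ with the primitive $F$; (ii) $h$ is locally McShane integrable on $\mathbb{R}^m$ with a primitive $H:\mathcal{I}\to X$ such that $H(I)=F(I)$ for all $I\in\mathcal{I}_G$, and $$H(I)=\sum_{k:\,|I\cap C_k|>0}F(I\cap C_k),\quad\text{for all } I\in\mathcal{I},$$ whenever $(C_k)\in\mathscr{D}_{G^{o}}$.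
   Context: $\|\cdot\|$ is the norm of $X$. $\mathbb{R}^m$ carries the maximum norm, and $B_m(t,r)$ is the open ball with center $t$ and radius $r>0$. $|A|$ is the Lebesgue measure of $A\subset\mathbb{R}^m$; $A^{o}$ is the interior of $A$. Intervals. A closed non-degenerate interval in $\mathbb{R}^m$ is a set $\prod_{j=1}^m[a_j,b_j]$ with $-\infty<a_j<b_j<+\infty$. $\mathcal{I}$ is the family of all of these (so $\mathcal{I}=\mathcal{I}_{\mathbb{R}^m}$), and for $E\subset\mathbb{R}^m$, $\mathcal{I}_E$ is the family of those contained in $E$. Two intervals $I,J$ are non-overlapping if $I^{o}\cap J^{o}=\emptyset$. A function $F:\mathcal{I}_E\to X$ is an additive interval function if $F(I\cup J)=F(I)+F(J)$ for all non-overlapping $I,J\in\mathcal{I}_E$ with $I\cup J\in\mathcal{I}_E$. Partitions. An $\mathcal{M}$-tagged interval in $E$ is a pair $(t,I)$ with $t\in E$ and $I\in\mathcal{I}_E$ ($t$ need not lie in $I$). An $\mathcal{M}$-partition in $E$ is a finite collection $\{(t_i,I_i)\}_{i=1}^p$ of $\mathcal{M}$-tagged intervals in $E$ with the $I_i$ pairwise non-overlapping; it is a partition of $E$ if $\bigcup_i I_i=E$. A gauge on $Z$ is a function $\delta:Z\to(0,+\infty)$. A partition is $Z$-tagged if all $t_i\in Z$, and $\delta$-fine if $I_i\subset B_m(t_i,\delta(t_i))$ for all $i$. McShane integral. For $J\in\mathcal{I}$, $g:J\to X$ is McShane integrable on $J$ with integral $x\in X$ if for every $\varepsilon>0$ there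 is a gauge $\delta$ on $J$ such that $\|\sum_{(t,I)\in\pi}g(t)|I|-x\|<\varepsilon$ for every $\delta$-fine $\mathcal{M}$-partition $\pi$ of $J$. A McShane integrable $g$ is McShane integrable on every $I\in\mathcal{I}_J$, and its primitive is the additive interval function $I\mapsto (M)\int_I g\,d\lambda$, $I\in\mathcal{I}_J$. Local integrability. For $W\subset\mathbb{R}^m$ open, $v:W\to X$ and an additive interval function $V:\mathcal{I}_W\to X$, $v$ is locally McShane integrable on $W$ with the primitive $V$ if for each $J\in\mathcal{I}_W$ the restriction $v|_J$ is McShane integrable on $J$ with the primitive $V|_{\mathcal{I}_J}$. Divisions. Let $E\subset\mathbb{R}^m$ with $|E\setminus E^{o}|=0$. A division of $E^{o}$ is a sequence $(I_k)_{k\ge1}$ of pairwise non-overlapping intervals in $\mathcal{I}_E$ with $E^{o}=\bigcup_{k=1}^{\infty}I_k$; $\mathscr{D}_{E^{o}}$ is the family of all divisions of $E^{o}$. Hake-function. An additive interval function $F:\mathcal{I}_E\to X$ is a Hake-function if for every division $(I_k)\in\mathscr{D}_{E^{o}}$: the series $\sum_{k:|I\cap I_k|>0}F(I\cap I_k)$ is unconditionally convergent in $X$ for each $I\in\mathcal{I}$, and $F(I)=\sum_{k:|I\cap I_k|>0}F(I\cap I_k)$ for all $I\in\mathcal{I}_E$. Negligible variation. An additive interval function $F:\mathcal{I}_E\to X$ has $\mathcal{M}$-negligible variation over $Z\subset\mathbb{R}^m$ if for each $\varepsilon>0$ there is a gauge $\delta_v$ on $Z$ such that for each $Z$-tagged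 $\delta_v$-fine $\mathcal{M}$-partition $\pi_v$ in $\mathbb{R}^m$ and every $(I_k)\in\mathscr{D}_{E^{o}}$: the series $\sum_{k:|I\cap I_k|>0}F(I\cap I_k)$ is unconditionally convergent in $X$ for each $(t,I)\in\pi_v$, and $\left\|\sum_{(t,I)\in\pi_v}\left(\sum_{k:|I\cap I_k|>0}F(I\cap I_k)\right)\right\|<\varepsilon$. $F$ has $\mathcal{M}$-negligible variation outside of $E^{o}$ if it has $\mathcal{M}$-negligible variation over $\mathbb{R}^m\setminus E^{o}$. Hake-McShane integral. $f:E\to X$ is Hake-McShane integrable on $E$ with the primitive $F:\mathcal{I}_E\to X$ (an additive interval function) if: (a) for each $\varepsilon>0$ there is a gauge $\delta_\varepsilon$ on $E^{o}$ such that $\|\sum_{(t,I)\in\pi}(f(t)|I|-F(I))\|<\varepsilon$ for each $\delta_\varepsilon$-fine $\mathcal{M}$-partition $\pi$ in $E^{o}$; (b) $F$ is a Hake-function; (c) $F$ has $\mathcal{M}$-negligible variation outside of $E^{o}$. *)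

theory Defs
  imports "HOL-Analysis.Analysis"
begin

text \<open>
  Functions \<open>g : J \<rightarrow> X\<close>, gauges on a set \<open>Z\<close> and interval functions on the intervals in \<open>E\<close>
  are total functions here; every definition below inspects only their values on \<open>J\<close>, on \<open>Z\<close>,
  and on \<open>intervals_in E\<close>, respectively.  The index type \<open>'m\<close> is finite and nonempty, so that
  \<open>real ^ 'm\<close> ranges over the spaces of all dimensions at least 1.
\<close>

text \<open>\<open>infnorm\<close> is the maximum norm; the library's \<open>ball\<close> is Euclidean.\<close>

definition max_ball :: "real ^ 'm \<Rightarrow> real \<Rightarrow> (real ^ 'm) set" where
  "max_ball t r = {s. infnorm (s - t) < r}"

definition intervals_in :: "(real ^ 'm) set \<Rightarrow> (real ^ 'm) set set" where
  "intervals_in E = {I. I \<subseteq> E \<and> (\<exists>a b. (\<forall>j. a $ j < b $ j) \<and> I = cbox a b)}"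

definition nonoverlapping :: "(real ^ 'm) set \<Rightarrow> (real ^ 'm) set \<Rightarrow> bool" where
  "nonoverlapping I J \<longleftrightarrow> interior I \<inter> interior J = {}"

definition additive_interval_function ::
    "(real ^ 'm) set \<Rightarrow> ((real ^ 'm) set \<Rightarrow> 'x::real_normed_vector) \<Rightarrow> bool" where
  "additive_interval_function E F \<longleftrightarrow>
     (\<forall>I \<in> intervals_in E. \<forall>J \<in> intervals_in E.
        nonoverlapping I J \<and> I \<union> J \<in> intervals_in E \<longrightarrow> F (I \<union> J) = F I + F J)"

text \<open>
  A partition is a set of tagged intervals rather than an indexed family.  This loses nothing:
  nondegenerate intervals that do not overlap are distinct.  Note that a tag need not belong to
  its interval.
\<close>

definition M_partition_in ::
    "(real ^ 'm) set \<Rightarrow> ((real ^ 'm) \<times> (real ^ 'm) set) set \<Rightarrow> bool" where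
  "M_partition_in E \<pi> \<longleftrightarrow>
     finite \<pi> \<and> (\<forall>(t, I) \<in> \<pi>. t \<in> E \<and> I \<in> intervals_in E) \<and>
     (\<forall>p \<in> \<pi>. \<forall>q \<in> \<pi>. p \<noteq> q \<longrightarrow> nonoverlapping (snd p) (snd q))"

definition M_partition_of ::
    "(real ^ 'm) set \<Rightarrow> ((real ^ 'm) \<times> (real ^ 'm) set) set \<Rightarrow> bool" where
  "M_partition_of E \<pi> \<longleftrightarrow> M_partition_in E \<pi> \<and> (\<Union>(t, I) \<in> \<pi>. I) = E"

definition gauge_on :: "(real ^ 'm) set \<Rightarrow> (real ^ 'm \<Rightarrow> real) \<Rightarrow> bool" where
  "gauge_on Z \<delta> \<longleftrightarrow> (\<forall>t \<in> Z. 0 < \<delta> t)"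

definition tagged_in ::
    "(real ^ 'm) set \<Rightarrow> ((real ^ 'm) \<times> (real ^ 'm) set) set \<Rightarrow> bool" where
  "tagged_in Z \<pi> \<longleftrightarrow> (\<forall>(t, I) \<in> \<pi>. t \<in> Z)"

definition gauge_fine ::
    "(real ^ 'm \<Rightarrow> real) \<Rightarrow> ((real ^ 'm) \<times> (real ^ 'm) set) set \<Rightarrow> bool" where
  "gauge_fine \<delta> \<pi> \<longleftrightarrow> (\<forall>(t, I) \<in> \<pi>. I \<subseteq> max_ball t (\<delta> t))"

definition has_McShane_integral ::
    "(real ^ 'm \<Rightarrow> 'x::real_normed_vector) \<Rightarrow> 'x \<Rightarrow> (real ^ 'm) set \<Rightarrow> bool" where
  "has_McShane_integral g x J \<longleftrightarrow>
     (\<forall>\<epsilon>>0. \<exists>\<delta>. gauge_on J \<delta> \<and>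
        (\<forall>\<pi>. M_partition_of J \<pi> \<and> gauge_fine \<delta> \<pi> \<longrightarrow>
           norm ((\<Sum>(t, I) \<in> \<pi>. measure lebesgue I *\<^sub>R g t) - x) < \<epsilon>))"

definition McShane_integrable_on ::
    "(real ^ 'm \<Rightarrow> 'x::real_normed_vector) \<Rightarrow> (real ^ 'm) set \<Rightarrow> bool" where
  "McShane_integrable_on g J \<longleftrightarrow> (\<exists>x. has_McShane_integral g x J)"

definition McShane_integrable_with_primitive ::
    "(real ^ 'm \<Rightarrow> 'x::real_normed_vector) \<Rightarrow> ((real ^ 'm) set \<Rightarrow> 'x) \<Rightarrow>
       (real ^ 'm) set \<Rightarrow> bool" where
  "McShane_integrable_with_primitive g P J \<longleftrightarrow>
     McShane_integrable_on g J \<and> (\<forall>I \<in> intervals_in J. has_McShane_integral g (P I) I)"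

definition locally_McShane_integrable_with_primitive ::
    "(real ^ 'm \<Rightarrow> 'x::real_normed_vector) \<Rightarrow> ((real ^ 'm) set \<Rightarrow> 'x) \<Rightarrow>
       (real ^ 'm) set \<Rightarrow> bool" where
  "locally_McShane_integrable_with_primitive v V W \<longleftrightarrow>
     additive_interval_function W V \<and>
     (\<forall>J \<in> intervals_in W. McShane_integrable_with_primitive v V J)"

text \<open>Sequences are indexed from 0 instead of 1.\<close>

definition divisions :: "(real ^ 'm) set \<Rightarrow> (nat \<Rightarrow> (real ^ 'm) set) set" where
  "divisions E =
     {C. (\<forall>k. C k \<in> intervals_in E) \<and> (\<forall>i j. i \<noteq> j \<longrightarrow> nonoverlapping (C i) (C j)) \<and>
         interior E = (\<Union>k. C k)}"

text \<open>
  The series of \<open>F (I \<inter> C k)\<close> over all \<open>k\<close> such that \<open>I \<inter> C k\<close> has positive measure is written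
  as a series over all \<open>k\<close> by inserting zero terms.  The sum of a series is the limit of its
  partial sums (\<open>sums\<close>, \<open>suminf\<close>); unconditional convergence is \<open>summable_on UNIV\<close>,
  i.e. convergence of the net of all finite partial sums.
\<close>

definition overlap_term ::
    "((real ^ 'm) set \<Rightarrow> 'x::real_normed_vector) \<Rightarrow> (nat \<Rightarrow> (real ^ 'm) set) \<Rightarrow>
       (real ^ 'm) set \<Rightarrow> nat \<Rightarrow> 'x" where
  "overlap_term F C I k = (if measure lebesgue (I \<inter> C k) > 0 then F (I \<inter> C k) else 0)"

definition Hake_function ::
    "(real ^ 'm) set \<Rightarrow> ((real ^ 'm) set \<Rightarrow> 'x::real_normed_vector) \<Rightarrow> bool" where
  "Hake_function E F \<longleftrightarrow>
     additive_interval_function E F \<and>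
     (\<forall>C \<in> divisions E.
        (\<forall>I \<in> intervals_in UNIV. overlap_term F C I summable_on UNIV) \<and>
        (\<forall>I \<in> intervals_in E. overlap_term F C I sums F I))"

definition M_negligible_variation_over ::
    "(real ^ 'm) set \<Rightarrow> ((real ^ 'm) set \<Rightarrow> 'x::real_normed_vector) \<Rightarrow>
       (real ^ 'm) set \<Rightarrow> bool" where
  "M_negligible_variation_over E F Z \<longleftrightarrow>
     additive_interval_function E F \<and>
     (\<forall>\<epsilon>>0. \<exists>\<delta>. gauge_on Z \<delta> \<and>
        (\<forall>\<pi>. M_partition_in UNIV \<pi> \<and> tagged_in Z \<pi> \<and> gauge_fine \<delta> \<pi> \<longrightarrow>
           (\<forall>C \<in> divisions E.
              (\<forall>(t, I) \<in> \<pi>. overlap_term F C I summable_on UNIV) \<and>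
              norm (\<Sum>(t, I) \<in> \<pi>. \<Sum>k. overlap_term F C I k) < \<epsilon>)))"

definition M_negligible_variation_outside_interior ::
    "(real ^ 'm) set \<Rightarrow> ((real ^ 'm) set \<Rightarrow> 'x::real_normed_vector) \<Rightarrow> bool" where
  "M_negligible_variation_outside_interior E F \<longleftrightarrow>
     M_negligible_variation_over E F (UNIV - interior E)"

definition Hake_McShane_integrable_with_primitive ::
    "(real ^ 'm \<Rightarrow> 'x::real_normed_vector) \<Rightarrow> ((real ^ 'm) set \<Rightarrow> 'x) \<Rightarrow>
       (real ^ 'm) set \<Rightarrow> bool" where
  "Hake_McShane_integrable_with_primitive f F E \<longleftrightarrow>
     additive_interval_function E F \<and>
     (\<forall>\<epsilon>>0. \<exists>\<delta>. gauge_on (interior E) \<delta> \<and>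
        (\<forall>\<pi>. M_partition_in (interior E) \<pi> \<and> gauge_fine \<delta> \<pi> \<longrightarrow>
           norm (\<Sum>(t, I) \<in> \<pi>. measure lebesgue I *\<^sub>R f t - F I) < \<epsilon>)) \<and>
     Hake_function E F \<and>
     M_negligible_variation_outside_interior E F"

end

theory Submission
  imports Defs
begin

text \<open>
  (i) implies (ii): for a fixed division \<open>E\<close> of the interior of \<open>G\<close> put \<open>H I = (\<Sum>k. F (I \<inter> E k))\<close>.
  A fine partition of an interval splits into the pairs with tags in the interior, which a small
  enough gauge confines to the interior, so that condition (a) applies to them, and the remaining
  pairs, whose sum is controlled by the negligible variation of \<open>F\<close> and by \<open>G - interior G\<close> being
  a null set.  That \<open>H\<close> does not depend on \<open>E\<close> is clear for divisions with a common refinement;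
  a Whitney division has a common refinement with every division.

  (ii) implies (i): (a) and (c) follow from the Saks-Henstock lemma for \<open>h\<close> on the whole space, and
  the unconditional convergence in (b) from the absolute continuity of \<open>H\<close>.
\<close>

section \<open>Intervals and additive interval functions\<close>

text \<open>Statement (ii) asks one \<open>H\<close> to match every division at once. Divisions are
  compared through a double series: a common refinement is again a division, so the Hake property
  gives unconditional convergence of the double series, and the Hake property on
  \<open>I \<inter> C k\<close> or \<open>I \<inter> E j\<close> evaluates the inner sums. The
  delicate point is whether the refinement covers the interior, because a point of
  \<open>C k\<close> could meet the members of the other division only in flat intersections. The
  geometry of Whitney cubes excludes this: a short segment from the point into \<open>C k\<close>
  stays in one cube containing the point. The negligible variation requires one gauge for all
  divisions. For (ii) implies (i) this comes for free, since every division sums to the same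
  \<open>H I\<close>. The terms are vectors, and absolute convergence is not at hand. Tails are
  therefore controlled by norms of finite sums, and here the freedom of McShane tags enters: an
  interval can be cut into pieces without moving its tag, so small total measure forces a small
  sum.\<close>

lemma intervals_in_iff:
  "I \<in> intervals_in E \<longleftrightarrow> I \<subseteq> E \<and> (\<exists>a b. I = cbox a b) \<and> interior I \<noteq> {}"
proof -
  have "(\<forall>j. a $ j < b $ j) \<longleftrightarrow> interior (cbox a b) \<noteq> {}" for a b :: "real ^ 'm"
    by (simp add: interval_ne_empty_cart)
  then show ?thesis
    unfolding intervals_in_def by blast
qed

lemma cbox_in_intervals:
  assumes "\<And>j. a $ j < b $ j" "cbox a b \<subseteq> E"
  shows "cbox a b \<in> intervals_in E"
  unfolding intervals_in_def using assms by blast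

lemma intervals_inE:
  assumes "I \<in> intervals_in E"
  obtains a b where "I = cbox a b" "interior I \<noteq> {}" "I \<subseteq> E"
  using assms unfolding intervals_in_iff by blast

lemma intervals_in_imp_UNIV: "I \<in> intervals_in E \<Longrightarrow> I \<in> intervals_in UNIV"
  by (auto simp: intervals_in_iff)

lemma intervals_in_subset: "I \<in> intervals_in E \<Longrightarrow> I \<subseteq> E"
  by (auto simp: intervals_in_iff)

lemma negligible_cbox_iff: "negligible (cbox a b) \<longleftrightarrow> interior (cbox a b) = {}"
  by (simp add: negligible_interval)

lemma measure_cbox_pos_iff: "measure lebesgue (cbox a b) > 0 \<longleftrightarrow> interior (cbox a b) \<noteq> {}"
proof -
  have "measure lebesgue (cbox a b) = 0 \<longleftrightarrow> negligible (cbox a b)"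
    by (simp add: negligible_iff_measure)
  then show ?thesis
    by (metis negligible_cbox_iff zero_less_measure_iff)
qed

lemma interval_lmeasurable: "I \<in> intervals_in E \<Longrightarrow> I \<in> lmeasurable"
  by (auto simp: intervals_in_iff)

lemma cbox_Int_cbox: "\<exists>u v. cbox a b \<inter> cbox c d = cbox u (v :: 'a :: euclidean_space)"
  unfolding Int_interval by blast

lemma Int_intervals_in:
  assumes "I \<in> intervals_in UNIV" "K \<in> intervals_in E" "interior (I \<inter> K) \<noteq> {}"
  shows "I \<inter> K \<in> intervals_in E"
  using assms cbox_Int_cbox unfolding intervals_in_iff by blast

text \<open>Two boxes meet in a box, where positive measure and nonempty interior agree. The series
  are written with measures, the later case distinctions with interiors.\<close>

lemma measure_Int_pos_iff:
  assumes "I \<in> intervals_in E" "K \<in> intervals_in E'"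
  shows "measure lebesgue (I \<inter> K) > 0 \<longleftrightarrow> interior (I \<inter> K) \<noteq> {}"
proof -
  obtain u v where "I \<inter> K = cbox u v"
    using assms cbox_Int_cbox unfolding intervals_in_iff by metis
  then show ?thesis
    by (metis measure_cbox_pos_iff)
qed

lemma nonoverlapping_iff_negligible:
  assumes "I \<in> intervals_in E" "K \<in> intervals_in E'"
  shows "nonoverlapping I K \<longleftrightarrow> negligible (I \<inter> K)"
proof -
  obtain u v where "I \<inter> K = cbox u v"
    using assms cbox_Int_cbox unfolding intervals_in_iff by metis
  then show ?thesis
    by (metis interior_Int negligible_cbox_iff nonoverlapping_def)
qed

lemma closure_interior_interval:
  assumes "I \<in> intervals_in E" shows "closure (interior I) = I"
  using assms unfolding intervals_in_iff by (metis closure_box interior_cbox)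

lemma sum_measure_nonoverlapping_le:
  assumes "finite A" "\<And>x. x \<in> A \<Longrightarrow> K x \<in> intervals_in E" "S \<in> lmeasurable"
    and "\<And>x. x \<in> A \<Longrightarrow> K x \<subseteq> S"
    and "\<And>x y. x \<in> A \<Longrightarrow> y \<in> A \<Longrightarrow> x \<noteq> y \<Longrightarrow> nonoverlapping (K x) (K y)"
  shows "(\<Sum>x\<in>A. measure lebesgue (K x)) \<le> measure lebesgue S"
proof -
  have "(\<Sum>x\<in>A. measure lebesgue (K x)) = measure lebesgue (\<Union>(K ` A))"
  proof (intro measure_negligible_finite_Union_image [symmetric] pairwiseI)
    show "K x \<in> lmeasurable" if "x \<in> A" for x
      by (rule interval_lmeasurable) (rule assms(2) [OF that])
    show "negligible (K x \<inter> K y)" if "x \<in> A" "y \<in> A" "x \<noteq> y" for x y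
      using assms that nonoverlapping_iff_negligible by meson
  qed (rule assms)
  also have "\<dots> \<le> measure lebesgue S"
  proof (rule measure_mono_fmeasurable)
    show "\<Union> (K ` A) \<in> sets lebesgue"
      using assms interval_lmeasurable fmeasurableD
      by (intro sets.finite_UN) blast+
  qed (use assms in auto)
  finally show ?thesis .
qed

lemma nonoverlapping_self_interval: "I \<in> intervals_in E \<Longrightarrow> \<not> nonoverlapping I I"
  by (auto simp: nonoverlapping_def intervals_in_iff)

lemma nonoverlapping_commute: "nonoverlapping I K \<longleftrightarrow> nonoverlapping K I"
  by (auto simp: nonoverlapping_def)

lemma nonoverlapping_mono: "nonoverlapping I K \<Longrightarrow> I' \<subseteq> I \<Longrightarrow> K' \<subseteq> K \<Longrightarrow> nonoverlapping I' K'"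
  unfolding nonoverlapping_def by (meson disjoint_iff interior_mono subsetD)

text \<open>An interval with interior overlaps itself, so two distinct pairs cannot share it. Sums
  over tagged pairs can therefore be rewritten as sums over the set of intervals, where the theory
  of divisions applies.\<close>

lemma M_partition_in_inj_on_snd:
  assumes "M_partition_in E \<pi>"
  shows "inj_on snd \<pi>"
proof (rule inj_onI)
  fix p q assume pq: "p \<in> \<pi>" "q \<in> \<pi>" "snd p = snd q"
  have "snd p \<in> intervals_in E"
    using assms pq(1) unfolding M_partition_in_def by fastforce
  then have "\<not> nonoverlapping (snd p) (snd q)"
    using nonoverlapping_self_interval pq(3) by metis
  then show "p = q"
    using assms pq unfolding M_partition_in_def by blast
qed

lemma M_partition_in_division:
  assumes "M_partition_in E \<pi>"
  shows "(snd ` \<pi>) division_of \<Union>(snd ` \<pi>)"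
proof (rule division_ofI)
  have int: "K \<in> intervals_in E" if "K \<in> snd ` \<pi>" for K
    using assms that by (auto simp: M_partition_in_def)
  show "finite (snd ` \<pi>)"
    using assms by (auto simp: M_partition_in_def)
  show "K \<noteq> {}" "\<exists>a b. K = cbox a b" if "K \<in> snd ` \<pi>" for K
    using int [OF that] by (auto simp: intervals_in_iff)
  show "interior K \<inter> interior L = {}" if KL: "K \<in> snd ` \<pi>" "L \<in> snd ` \<pi>" "K \<noteq> L" for K L
  proof -
    obtain p q where "p \<in> \<pi>" "q \<in> \<pi>" "K = snd p" "L = snd q"
      using KL by blast
    then show ?thesis
      using assms KL(3) unfolding M_partition_in_def nonoverlapping_def by metis
  qed
qed auto

section \<open>Additivity across degenerate boxes\<close>

lemma negligible_imp_interior_empty: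
  assumes "negligible S" shows "interior S = {}"
proof (rule ccontr)
  assume "interior S \<noteq> {}"
  then obtain a b where "box a b \<noteq> {}" "cbox a b \<subseteq> interior S"
    using open_contains_cbox [OF open_interior] by (metis all_not_in_conv)
  then show False
    using assms interior_subset negligible_interval(1) negligible_subset by (metis subset_trans)
qed

text \<open>The part of the open box outside the closed set \<open>B\<close> is open and null, hence
  empty, and the box is the closure of its interior. A flat summand of a union can thus be
  dropped.\<close>

lemma cbox_Un_negligible:
  assumes "A \<union> B = cbox a b" "negligible A" "closed B" "interior (cbox a b) \<noteq> {}"
  shows "A \<union> B = B"
proof -
  have "interior (cbox a b) - B \<subseteq> A"
    using assms(1) interior_subset by blast
  then have "negligible (interior (cbox a b) - B)"
    using assms(2) negligible_subset by blast
  moreover have "open (interior (cbox a b) - B)"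
    using assms(3) by blast
  ultimately have "interior (cbox a b) - B = {}"
    using negligible_imp_interior_empty interior_open by metis
  then have "closure (interior (cbox a b)) \<subseteq> B"
    using assms(3) by (simp add: closure_minimal)
  then show ?thesis
    using assms(1,4) by auto
qed

text \<open>\<open>F\<close> is arbitrary on degenerate boxes. Giving those the value 0 makes
  additivity survive all cuts, including the ones that leave a flat piece;
  \<open>overlap_term\<close> extends \<open>F\<close> in the same way.\<close>

lemma additive_zero_extension:
  fixes F :: "(real ^ 'm) set \<Rightarrow> 'x::real_normed_vector"
  assumes F: "additive_interval_function E F"
    and A: "\<exists>a b. A = cbox a b" and B: "\<exists>a b. B = cbox a b"
    and AB: "\<exists>a b. A \<union> B = cbox a b" "A \<union> B \<subseteq> E" and no: "nonoverlapping A B"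
  shows "(if interior (A \<union> B) \<noteq> {} then F (A \<union> B) else 0) =
         (if interior A \<noteq> {} then F A else 0) + (if interior B \<noteq> {} then F B else 0)"
proof -
  obtain a b where ab: "A \<union> B = cbox a b"
    using AB by blast
  have mono: "interior A \<subseteq> interior (A \<union> B)" "interior B \<subseteq> interior (A \<union> B)"
    by (simp_all add: interior_mono)
  have cl: "closed A" "closed B"
    using A B by auto
  have neg: "negligible A \<longleftrightarrow> interior A = {}" "negligible B \<longleftrightarrow> interior B = {}"
    using A B negligible_cbox_iff by blast+
  consider "interior A \<noteq> {}" "interior B \<noteq> {}" | "interior (A \<union> B) = {}"
    | "interior (A \<union> B) \<noteq> {}" "interior A = {}" | "interior (A \<union> B) \<noteq> {}" "interior B = {}"
    by blast
  then show ?thesis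
  proof cases
    case 1
    have "interior (A \<union> B) \<noteq> {}"
      using 1 mono by blast
    then have "A \<in> intervals_in E" "B \<in> intervals_in E" "A \<union> B \<in> intervals_in E"
      using 1 A B AB unfolding intervals_in_iff by simp_all
    then have "F (A \<union> B) = F A + F B"
      using F no unfolding additive_interval_function_def by blast
    then show ?thesis
      using 1 \<open>interior (A \<union> B) \<noteq> {}\<close> by simp
  next
    case 2
    then show ?thesis using mono by auto
  next
    case 3
    then have "A \<union> B = B"
      using cbox_Un_negligible [OF ab] neg cl ab by metis
    then show ?thesis using 3 by simp
  next
    case 4
    then have "A \<union> B = A"
      using cbox_Un_negligible [of B A a b] neg cl ab by (metis Un_commute)
    then show ?thesis using 4 by simp
  qed
qed

text \<open>Additivity is given only for two intervals whose union is again an interval, and a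
  division need not be assembled by such gluings. The zero extension \<open>g\<close> is additive
  under hyperplane cuts, i.e. \<open>operative\<close>, and this yields its value on every
  division.\<close>

lemma additive_interval_function_division:
  fixes H :: "(real ^ 'm) set \<Rightarrow> 'x::real_normed_vector"
  assumes H: "additive_interval_function UNIV H" and J: "J \<in> intervals_in UNIV"
    and D: "D division_of J" and ne: "\<And>K. K \<in> D \<Longrightarrow> interior K \<noteq> {}"
  shows "H J = (\<Sum>K\<in>D. H K)"
proof -
  define g where "g K = (if interior K = {} then 0 else H K)" for K
  have "operative plus 0 g"
  proof
    fix a b :: "real ^ 'm"
    show "g (cbox a b) = 0" if "box a b = {}"
      using that by (simp add: g_def)
  next
    fix a b c and k :: "real ^ 'm"
    assume k: "k \<in> Basis"
    let ?A = "cbox a b \<inter> {x. x \<bullet> k \<le> c}" and ?B = "cbox a b \<inter> {x. c \<le> x \<bullet> k}"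
    have boxes: "\<exists>u v. ?A = cbox u v" "\<exists>u v. ?B = cbox u v"
      using interval_split [OF k] by blast+
    have AB: "?A \<union> ?B = cbox a b"
      by auto
    have "k \<noteq> 0"
      using k by auto
    then have "interior {x. x \<bullet> k \<le> c} \<inter> interior {x. c \<le> x \<bullet> k} = {}"
      using interior_halfspace_le [of k c] interior_halfspace_ge [of k c]
      by (auto simp: inner_commute)
    then have no: "nonoverlapping ?A ?B"
      by (auto simp: nonoverlapping_def)
    show "g (cbox a b) = g ?A + g ?B"
    proof -
      have g: "g K = (if interior K \<noteq> {} then H K else 0)" for K
        by (simp add: g_def)
      show ?thesis
        using additive_zero_extension [OF H boxes _ _ no] unfolding AB g by blast
    qed
  qed
  then interpret operative plus 0 g .
  obtain a b where ab: "J = cbox a b" "interior J \<noteq> {}"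
    using J by (rule intervals_inE)
  have "sum g D = g J"
    using division [of D a b] D ab(1) by (simp only: sum_def)
  moreover have "sum g D = sum H D"
    using ne by (intro sum.cong refl) (simp add: g_def)
  ultimately show ?thesis
    using ab(2) unfolding g_def by presburger
qed

section \<open>The Saks-Henstock lemma\<close>

lemma max_ball_mono: "r \<le> s \<Longrightarrow> max_ball t r \<subseteq> max_ball t s"
  by (auto simp: max_ball_def)

lemma ball_subset_max_ball: "ball t r \<subseteq> max_ball t r"
proof
  fix s assume "s \<in> ball t r"
  then show "s \<in> max_ball t r"
    using infnorm_le_norm [of "s - t"] by (simp add: max_ball_def dist_norm norm_minus_commute)
qed

lemma centre_in_max_ball: "0 < r \<Longrightarrow> t \<in> max_ball t r"
  by (simp add: max_ball_def infnorm_0)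

lemma open_contains_max_ball:
  fixes U :: "(real ^ 'm) set"
  assumes "open U" "t \<in> U"
  obtains r where "r > 0" "max_ball t r \<subseteq> U"
proof -
  obtain e where e: "e > 0" "ball t e \<subseteq> U"
    using assms by (auto simp: open_contains_ball)
  \<comment> \<open>\<open>norm v \<le> c * infnorm v\<close>, so a max ball of radius
    \<open>e / c\<close> fits into the Euclidean ball of radius \<open>e\<close>.\<close>
  define c where "c = sqrt (real DIM(real ^ 'm))"
  have "c > 0"
    by (simp add: c_def)
  moreover have "max_ball t (e / c) \<subseteq> ball t e"
  proof
    fix s assume "s \<in> max_ball t (e / c)"
    then have "c * infnorm (s - t) < e"
      using \<open>c > 0\<close> by (simp add: max_ball_def field_simps)
    then show "s \<in> ball t e"
      using norm_le_infnorm [of "s - t"] by (simp add: c_def dist_norm norm_minus_commute)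
  qed
  ultimately show thesis
    using that [of "e / c"] e by auto
qed

lemma gauge_fineD: "gauge_fine \<delta> \<pi> \<Longrightarrow> (t, I) \<in> \<pi> \<Longrightarrow> I \<subseteq> max_ball t (\<delta> t)"
  by (auto simp: gauge_fine_def)

lemma gauge_fineI: "(\<And>t I. (t, I) \<in> \<pi> \<Longrightarrow> I \<subseteq> max_ball t (\<delta> t)) \<Longrightarrow> gauge_fine \<delta> \<pi>"
  by (auto simp: gauge_fine_def)

lemma gauge_fine_subset: "gauge_fine \<delta> \<pi> \<Longrightarrow> \<pi>' \<subseteq> \<pi> \<Longrightarrow> gauge_fine \<delta> \<pi>'"
  by (auto simp: gauge_fine_def)

lemma gauge_fine_mono:
  assumes "gauge_fine \<delta> \<pi>" "\<And>t I. (t, I) \<in> \<pi> \<Longrightarrow> \<delta> t \<le> \<delta>' t"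
  shows "gauge_fine \<delta>' \<pi>"
  unfolding gauge_fine_def
proof clarify
  fix t I s assume ti: "(t, I) \<in> \<pi>" and s: "s \<in> I"
  have "I \<subseteq> max_ball t (\<delta> t)"
    using assms(1) ti by (auto simp: gauge_fine_def)
  then show "s \<in> max_ball t (\<delta>' t)"
    using s max_ball_mono [OF assms(2) [OF ti]] by blast
qed

lemma M_partition_in_subset: "M_partition_in E \<pi> \<Longrightarrow> \<pi>' \<subseteq> \<pi> \<Longrightarrow> M_partition_in E \<pi>'"
  unfolding M_partition_in_def by (meson finite_subset subsetD)

lemma M_partition_in_restrict:
  assumes "M_partition_in E \<pi>" "\<And>t I. (t, I) \<in> \<pi> \<Longrightarrow> t \<in> J" "\<And>t I. (t, I) \<in> \<pi> \<Longrightarrow> I \<subseteq> J"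
  shows "M_partition_in J \<pi>"
proof -
  have "t \<in> J \<and> I \<in> intervals_in J" if tI: "(t, I) \<in> \<pi>" for t I
  proof -
    have "I \<in> intervals_in E"
      using assms(1) tI by (auto simp: M_partition_in_def)
    then show ?thesis
      using assms(2,3) [OF tI] by (simp add: intervals_in_iff)
  qed
  then have "\<forall>(t, I)\<in>\<pi>. t \<in> J \<and> I \<in> intervals_in J"
    by blast
  then show ?thesis
    using assms(1) by (simp add: M_partition_in_def)
qed

text \<open>Cousin's lemma. Euclidean balls lie inside max balls of the same radius, so a tagged
  division fine for the former is fine for the latter; what remains is to throw away its degenerate
  members.\<close>

lemma fine_M_partition_exists:
  fixes J :: "(real ^ 'm) set"
  assumes J: "J \<in> intervals_in UNIV" and \<delta>: "gauge_on J \<delta>"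
  obtains \<pi> where "M_partition_of J \<pi>" "gauge_fine \<delta> \<pi>"
proof -
  obtain a b where ab: "J = cbox a b" "interior J \<noteq> {}"
    using J by (rule intervals_inE)
  \<comment> \<open>The radius 1 outside \<open>J\<close> only completes the gauge to the whole
    space; tags of a tagged division belong to their intervals, hence to \<open>J\<close>.\<close>
  define g where "g t = ball t (if t \<in> J then \<delta> t else 1)" for t
  have "gauge g"
    unfolding g_def using \<delta> by (intro gauge_ball_dependent) (auto simp: gauge_on_def)
  then obtain p where p: "p tagged_division_of (cbox a b)" "g fine p"
    by (rule fine_division_exists)
  note pD = tagged_division_ofD [OF p(1)]
  define \<pi> where "\<pi> = {q \<in> p. interior (snd q) \<noteq> {}}"
  have content: "measure lborel K \<noteq> 0 \<longleftrightarrow> interior K \<noteq> {}" if K: "K \<in> snd ` p" for K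
  proof -
    obtain x where "(x, K) \<in> p"
      using K by auto
    then obtain u v where "K = cbox u v"
      using pD(4) by blast
    then show ?thesis
      using content_eq_0_interior by blast
  qed
  have "{K. K \<in> snd ` p \<and> measure lborel K \<noteq> 0} division_of cbox a b"
    using division_of_tagged_division [OF p(1)] content_eq_0_interior ab
    by (intro division_of_nontrivial) auto
  then have "\<Union>{K. K \<in> snd ` p \<and> measure lborel K \<noteq> 0} = J"
    using ab by (simp add: division_of_def)
  moreover have "{K. K \<in> snd ` p \<and> measure lborel K \<noteq> 0} = snd ` \<pi>"
  proof -
    have "snd ` \<pi> = {K. K \<in> snd ` p \<and> interior K \<noteq> {}}"
      by (force simp: \<pi>_def)
    moreover have "K \<in> snd ` p \<and> measure lborel K \<noteq> 0 \<longleftrightarrow> K \<in> snd ` p \<and> interior K \<noteq> {}" for K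
      by (rule conj_cong [OF refl content])
    ultimately show ?thesis
      by simp
  qed
  ultimately have UN: "(\<Union>(t, I)\<in>\<pi>. I) = J"
    by (simp add: case_prod_unfold)
  have "M_partition_in J \<pi>"
    unfolding M_partition_in_def
  proof (intro conjI ballI impI)
    show "finite \<pi>"
      using pD(1) by (simp add: \<pi>_def)
  next
    fix q assume q: "q \<in> \<pi>"
    obtain t K where tK: "q = (t, K)"
      by fastforce
    have *: "(t, K) \<in> p" "interior K \<noteq> {}"
      using q tK by (auto simp: \<pi>_def)
    then show "case q of (t, I) \<Rightarrow> t \<in> J \<and> I \<in> intervals_in J"
      using pD(2-4) [OF *(1)] ab tK by (auto simp: intervals_in_iff)
  next
    fix q q' assume "q \<in> \<pi>" "q' \<in> \<pi>" "q \<noteq> q'"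
    then show "nonoverlapping (snd q) (snd q')"
      using pD(5) [of "fst q" "snd q" "fst q'" "snd q'"]
      by (auto simp: \<pi>_def nonoverlapping_def prod_eq_iff)
  qed
  moreover have "gauge_fine \<delta> \<pi>"
    unfolding gauge_fine_def
  proof clarify
    fix t K s assume "(t, K) \<in> \<pi>" and s: "s \<in> K"
    then have tK: "(t, K) \<in> p"
      by (simp add: \<pi>_def)
    have "s \<in> g t"
      using p(2) tK s by (auto simp: fine_def)
    moreover have "t \<in> J"
      using pD(2,3) [OF tK] ab(1) by auto
    ultimately show "s \<in> max_ball t (\<delta> t)"
      using ball_subset_max_ball [of t "\<delta> t"] by (auto simp: g_def)
  qed
  ultimately show thesis
    using that UN by (simp add: M_partition_of_def)
qed

text \<open>The minimum of the gauge of \<open>h\<close> on \<open>K\<close> and an outside gauge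
  keeps the sum close to \<open>x\<close> and makes the partition usable inside one that is fine for
  the outside gauge. This fills the gaps in the Saks-Henstock lemma.\<close>

lemma has_McShane_integral_fine_partition:
  fixes h :: "real ^ 'm \<Rightarrow> 'x::real_normed_vector"
  assumes "has_McShane_integral h x K" "K \<in> intervals_in J" "gauge_on J \<delta>" "\<epsilon> > 0"
  shows "\<exists>\<pi>. M_partition_of K \<pi> \<and> gauge_fine \<delta> \<pi> \<and>
    norm ((\<Sum>(t, I)\<in>\<pi>. measure lebesgue I *\<^sub>R h t) - x) < \<epsilon>"
proof -
  obtain \<gamma> where \<gamma>: "gauge_on K \<gamma>"
    "\<And>\<pi>. M_partition_of K \<pi> \<Longrightarrow> gauge_fine \<gamma> \<pi> \<Longrightarrow>
      norm ((\<Sum>(t, I)\<in>\<pi>. measure lebesgue I *\<^sub>R h t) - x) < \<epsilon>"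
    using assms(1,4) unfolding has_McShane_integral_def by blast
  have K: "K \<in> intervals_in UNIV" "K \<subseteq> J"
    using assms(2) by (auto simp: intervals_in_iff)
  have "gauge_on K (\<lambda>t. min (\<gamma> t) (\<delta> t))"
    using \<gamma>(1) assms(3) K by (auto simp: gauge_on_def)
  then obtain \<pi> where \<pi>: "M_partition_of K \<pi>" "gauge_fine (\<lambda>t. min (\<gamma> t) (\<delta> t)) \<pi>"
    using fine_M_partition_exists K by metis
  have "gauge_fine \<gamma> \<pi>" "gauge_fine \<delta> \<pi>"
    using \<pi>(2) by (auto intro: gauge_fine_mono)
  then show ?thesis
    using \<pi>(1) \<gamma>(2) by blast
qed

text \<open>A partial partition is completed by partitions of the missing intervals whose sums are
  as close to \<open>H\<close> as desired. The full partition errs by less than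
  \<open>\<epsilon>\<close>, so the given part errs by at most \<open>\<epsilon>\<close> plus an
  arbitrary slack; hence the non-strict bound.\<close>

lemma Saks_Henstock:
  fixes h :: "real ^ 'm \<Rightarrow> 'x::real_normed_vector"
  assumes H: "additive_interval_function UNIV H" and J: "J \<in> intervals_in UNIV"
    and int: "\<And>K. K \<in> intervals_in J \<Longrightarrow> has_McShane_integral h (H K) K"
    and "\<epsilon> > 0"
  shows "\<exists>\<delta>. gauge_on J \<delta> \<and> (\<forall>\<pi>. M_partition_in J \<pi> \<and> gauge_fine \<delta> \<pi> \<longrightarrow>
    norm (\<Sum>(t, I)\<in>\<pi>. measure lebesgue I *\<^sub>R h t - H I) \<le> \<epsilon>)"
proof -
  have JJ: "J \<in> intervals_in J"
    using J by (simp add: intervals_in_iff)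
  obtain \<delta> where \<delta>: "gauge_on J \<delta>"
    "\<And>\<pi>. M_partition_of J \<pi> \<Longrightarrow> gauge_fine \<delta> \<pi> \<Longrightarrow>
      norm ((\<Sum>(t, I)\<in>\<pi>. measure lebesgue I *\<^sub>R h t) - H J) < \<epsilon>"
    using int [OF JJ] \<open>\<epsilon> > 0\<close> unfolding has_McShane_integral_def by blast
  have "norm (\<Sum>(t, I)\<in>\<pi>. measure lebesgue I *\<^sub>R h t - H I) \<le> \<epsilon>"
    if \<pi>: "M_partition_in J \<pi>" "gauge_fine \<delta> \<pi>" for \<pi>
  proof (rule field_le_epsilon)
    fix \<eta> :: real assume "\<eta> > 0"
    let ?s = "\<lambda>\<pi>. \<Sum>(t, I)\<in>\<pi>. measure lebesgue I *\<^sub>R h t"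
    obtain a b where ab: "J = cbox a b" "interior J \<noteq> {}"
      using J by (rule intervals_inE)
    define D where "D = snd ` \<pi>"
    have D: "K \<in> intervals_in J" if "K \<in> D" for K
      using \<pi>(1) that by (auto simp: M_partition_in_def D_def)
    have "D division_of \<Union>D"
      unfolding D_def by (rule M_partition_in_division [OF \<pi>(1)])
    moreover have "{J} division_of J"
    proof -
      have "J \<noteq> {}"
        using ab(2) by auto
      then show ?thesis
        using ab(1) division_of_self by metis
    qed
    moreover have "\<Union>D \<subseteq> J"
      using D by (auto simp: intervals_in_iff)
    \<comment> \<open>The intervals of \<open>\<pi>\<close> extend to a division of
      \<open>J\<close>; its nondegenerate new members are the gaps to be filled.\<close>
    ultimately obtain r where r: "D \<subseteq> r" "r division_of J"
      by (rule partial_division_extend)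
    define r' where "r' = {K. K \<in> r \<and> measure lborel K \<noteq> 0}"
    have r'_div: "r' division_of J"
    proof -
      have "measure lborel (cbox a b) \<noteq> 0"
        using ab content_eq_0_interior by metis
      then show ?thesis
        using division_of_nontrivial [of r a b] r(2) ab(1) unfolding r'_def by simp
    qed
    have cont: "measure lborel K \<noteq> 0 \<longleftrightarrow> interior K \<noteq> {}" if "K \<in> r" for K
      using division_ofD(4) [OF r(2) that] content_eq_0_interior by blast
    have r': "K \<in> intervals_in J" if "K \<in> r'" for K
    proof -
      have "interior K \<noteq> {}"
        using that cont unfolding r'_def by blast
      then show ?thesis
        using division_ofD(2,4) [OF r'_div that] by (simp add: intervals_in_iff)
    qed
    have D_r': "D \<subseteq> r'"
    proof
      fix K assume K: "K \<in> D"
      then have "interior K \<noteq> {}"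
        using D by (simp add: intervals_in_iff)
      then show "K \<in> r'"
        using K r(1) cont by (auto simp: r'_def)
    qed
    have fin: "finite r'"
      using r'_div by (rule division_of_finite)
    have r'_no: "nonoverlapping K L" if "K \<in> r'" "L \<in> r'" "K \<noteq> L" for K L
      using division_ofD(5) [OF r'_div] that by (auto simp: nonoverlapping_def)
    define L where "L = r' - D"
    have L: "finite L" "L \<subseteq> r'" "L \<inter> D = {}"
      using fin by (auto simp: L_def)
    \<comment> \<open>The gaps share the slack equally; the \<open>+ 1\<close> covers the case
      without gaps.\<close>
    define \<eta>' where "\<eta>' = \<eta> / (card L + 1)"
    have \<eta>': "\<eta>' > 0" "card L * \<eta>' \<le> \<eta>"
      using \<open>\<eta> > 0\<close> by (auto simp: \<eta>'_def field_simps)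
    have "\<forall>K\<in>L. \<exists>\<pi>. M_partition_of K \<pi> \<and> gauge_fine \<delta> \<pi> \<and> norm (?s \<pi> - H K) < \<eta>'"
      using has_McShane_integral_fine_partition [OF int _ \<delta>(1) \<eta>'(1)] r' L by blast
    then obtain P where P: "\<And>K. K \<in> L \<Longrightarrow> M_partition_of K (P K)"
      "\<And>K. K \<in> L \<Longrightarrow> gauge_fine \<delta> (P K)" "\<And>K. K \<in> L \<Longrightarrow> norm (?s (P K) - H K) < \<eta>'"
      by metis
    have Pin: "M_partition_in K (P K)" "(\<Union>(t, I)\<in>P K. I) = K" if "K \<in> L" for K
      using P(1) [OF that] by (auto simp: M_partition_of_def)
    have P_sub: "snd p \<in> intervals_in K" "fst p \<in> K" if "K \<in> L" "p \<in> P K" for K p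
      using Pin(1) [OF that(1)] that(2) by (auto simp: M_partition_in_def case_prod_unfold)
    define \<rho> where "\<rho> = \<pi> \<union> (\<Union>K\<in>L. P K)"
    have fin_P: "finite \<pi>" "\<And>K. K \<in> L \<Longrightarrow> finite (P K)"
      using \<pi>(1) Pin by (auto simp: M_partition_in_def)
    have \<pi>_no: "nonoverlapping (snd p) (snd q)" if "p \<in> \<pi>" "K \<in> L" "q \<in> P K" for p q K
    proof -
      have "nonoverlapping (snd p) K"
        using that L D_r' r'_no [of "snd p" K] by (auto simp: D_def)
      then show ?thesis
        using nonoverlapping_mono P_sub(1) that intervals_in_subset by (metis order_refl)
    qed
    have P_no: "nonoverlapping (snd p) (snd q)"
      if "K \<in> L" "K' \<in> L" "K \<noteq> K'" "p \<in> P K" "q \<in> P K'" for p q K K'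
    proof -
      have "nonoverlapping K K'"
        using that L r'_no by blast
      then show ?thesis
        using nonoverlapping_mono P_sub(1) that intervals_in_subset by metis
    qed
    have self: "\<not> nonoverlapping (snd p) (snd p)" if "K \<in> L" "p \<in> P K" for p K
      using P_sub(1) [OF that] nonoverlapping_self_interval by blast
    have "M_partition_in J \<rho>"
      unfolding M_partition_in_def
    proof (intro conjI ballI impI)
      show "finite \<rho>"
        using fin_P L by (simp add: \<rho>_def)
      show "case p of (t, I) \<Rightarrow> t \<in> J \<and> I \<in> intervals_in J" if p: "p \<in> \<rho>" for p
      proof (cases "p \<in> \<pi>")
        case True
        then show ?thesis using \<pi>(1) by (auto simp: M_partition_in_def)
      next
        case False
        then obtain K where K: "K \<in> L" "p \<in> P K"
          using p by (auto simp: \<rho>_def)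
        have "K \<subseteq> J"
          using K r' L intervals_in_subset by blast
        then show ?thesis
          using P_sub [OF K] by (auto simp: intervals_in_iff case_prod_unfold)
      qed
      show "nonoverlapping (snd p) (snd q)" if pq: "p \<in> \<rho>" "q \<in> \<rho>" "p \<noteq> q" for p q
      proof -
        consider "p \<in> \<pi>" "q \<in> \<pi>" | K where "p \<in> \<pi>" "K \<in> L" "q \<in> P K"
          | K where "q \<in> \<pi>" "K \<in> L" "p \<in> P K"
          | K K' where "K \<in> L" "p \<in> P K" "K' \<in> L" "q \<in> P K'"
          using pq unfolding \<rho>_def by blast
        then show ?thesis
        proof cases
          case 1
          then show ?thesis using \<pi>(1) pq(3) by (auto simp: M_partition_in_def)
        next
          case 2
          then show ?thesis using \<pi>_no by blast
        next
          case 3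
          then show ?thesis using \<pi>_no nonoverlapping_commute by blast
        next
          case 4
          show ?thesis
          proof (cases "K = K'")
            case True
            then show ?thesis using 4 pq(3) Pin(1) [of K] by (auto simp: M_partition_in_def)
          next
            case False
            then show ?thesis using 4 P_no by blast
          qed
        qed
      qed
    qed
    moreover have "(\<Union>(t, I)\<in>\<rho>. I) = J"
    proof -
      have "(\<Union>(t, I)\<in>\<rho>. I) = \<Union>D \<union> (\<Union>K\<in>L. (\<Union>(t, I)\<in>P K. I))"
        by (auto simp: \<rho>_def D_def)
      also have "(\<Union>K\<in>L. (\<Union>(t, I)\<in>P K. I)) = \<Union>L"
        using Pin(2) by auto
      also have "\<Union>D \<union> \<Union>L = \<Union>r'"
        using D_r' by (auto simp: L_def)
      also have "\<dots> = J"
        using r'_div by (simp add: division_of_def)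
      finally show ?thesis .
    qed
    ultimately have "M_partition_of J \<rho>"
      by (simp add: M_partition_of_def)
    moreover have "gauge_fine \<delta> \<rho>"
      using \<pi>(2) P(2) unfolding gauge_fine_def \<rho>_def by blast
    ultimately have main: "norm (?s \<rho> - H J) < \<epsilon>"
      by (rule \<delta>(2))
    have "?s \<rho> = ?s \<pi> + (\<Sum>K\<in>L. ?s (P K))"
    proof -
      have "\<pi> \<inter> (\<Union>K\<in>L. P K) = {}"
        using \<pi>_no self by blast
      then have "?s \<rho> = ?s \<pi> + ?s (\<Union>K\<in>L. P K)"
        unfolding \<rho>_def using fin_P L by (intro sum.union_disjoint) auto
      also have "?s (\<Union>K\<in>L. P K) = (\<Sum>K\<in>L. ?s (P K))"
        using fin_P L P_no self by (intro sum.UNION_disjoint) blast+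
      finally show ?thesis .
    qed
    moreover have "H J = (\<Sum>(t, I)\<in>\<pi>. H I) + (\<Sum>K\<in>L. H K)"
    proof -
      have "H J = (\<Sum>K\<in>r'. H K)"
        using r' by (intro additive_interval_function_division [OF H J r'_div]) (auto simp: intervals_in_iff)
      also have "\<dots> = (\<Sum>K\<in>D. H K) + (\<Sum>K\<in>L. H K)"
        using sum.subset_diff [OF D_r' fin, of H] by (simp add: L_def add.commute)
      also have "(\<Sum>K\<in>D. H K) = (\<Sum>(t, I)\<in>\<pi>. H I)"
        unfolding D_def using M_partition_in_inj_on_snd [OF \<pi>(1)]
        by (simp add: sum.reindex case_prod_unfold)
      finally show ?thesis .
    qed
    moreover have "(\<Sum>(t, I)\<in>\<pi>. measure lebesgue I *\<^sub>R h t - H I) = ?s \<pi> - (\<Sum>(t, I)\<in>\<pi>. H I)"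
      by (simp add: case_prod_unfold sum_subtractf)
    \<comment> \<open>The error on the given pairs is the total error minus the errors on the gaps:
      the first is controlled by \<open>\<delta>\<close>, the second by
      \<open>\<eta>\<close>.\<close>
    ultimately have eq: "(\<Sum>(t, I)\<in>\<pi>. measure lebesgue I *\<^sub>R h t - H I) =
        (?s \<rho> - H J) - (\<Sum>K\<in>L. ?s (P K) - H K)"
      by (simp add: sum_subtractf)
    have "norm (\<Sum>K\<in>L. ?s (P K) - H K) \<le> \<eta>"
      using sum_norm_bound [of L "\<lambda>K. ?s (P K) - H K" \<eta>'] P(3) \<eta>'(2) by force
    then show "norm (\<Sum>(t, I)\<in>\<pi>. measure lebesgue I *\<^sub>R h t - H I) \<le> \<epsilon> + \<eta>"
      unfolding eq
      using main norm_triangle_ineq4 [of "?s \<rho> - H J" "\<Sum>K\<in>L. ?s (P K) - H K"] by linarith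
  qed
  then show ?thesis
    using \<delta>(1) by blast
qed

section \<open>Partitions split into countably many levels\<close>

lemma sum_geometric_le:
  assumes "finite T" "e > 0"
  shows "(\<Sum>n\<in>T. e * (1/2) ^ (n + 2)) \<le> (e / 2 :: real)"
proof -
  have "(\<Sum>n\<in>T. (1/2 :: real) ^ n) \<le> (\<Sum>n. (1/2) ^ n)"
    using assms(1) by (intro sum_le_suminf summable_geometric) auto
  also have "\<dots> = 2"
    by (subst suminf_geometric) auto
  finally have "e / 4 * (\<Sum>n\<in>T. (1/2 :: real) ^ n) \<le> e / 4 * 2"
    using assms(2) by (intro mult_left_mono) auto
  then show ?thesis
    by (simp add: sum_distrib_left power_add field_simps)
qed

lemma sum_group_nat:
  assumes "finite \<pi>"
  shows "sum g \<pi> = (\<Sum>n\<in>\<nu> ` \<pi>. sum g {p \<in> \<pi>. \<nu> p = (n :: nat)})"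
  using sum.group [OF assms, of "\<nu> ` \<pi>" \<nu> g] assms by simp

text \<open>Tags are sorted into levels by the integer part of their max norm, and level
  \<open>n\<close> is charged \<open>\<epsilon> * (1/2) ^ (n + 2)\<close>. The total is at most
  \<open>\<epsilon> / 2\<close>, which also turns the non-strict local bounds into a strict
  one.\<close>

lemma global_Saks_Henstock:
  fixes h :: "real ^ 'm \<Rightarrow> 'x::real_normed_vector"
  assumes H: "additive_interval_function UNIV H"
    and int: "\<forall>K\<in>intervals_in UNIV. has_McShane_integral h (H K) K"
    and "\<epsilon> > 0"
  shows "\<exists>\<delta>. gauge_on UNIV \<delta> \<and> (\<forall>\<pi>. M_partition_in UNIV \<pi> \<and> gauge_fine \<delta> \<pi> \<longrightarrow>
    norm (\<Sum>(t, I)\<in>\<pi>. measure lebesgue I *\<^sub>R h t - H I) < \<epsilon>)"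
proof -
  \<comment> \<open>A tag of level \<open>n\<close> has max norm below \<open>n + 1\<close> and its
    gauge will be at most 1, so its interval stays in the cube of half-side
    \<open>n + 2\<close>.\<close>
  define J :: "nat \<Rightarrow> (real ^ 'm) set" where "J n = cbox (\<chi> i. - (real n + 2)) (\<chi> i. real n + 2)" for n
  have J: "J n \<in> intervals_in UNIV" for n
    unfolding J_def by (rule cbox_in_intervals) auto
  define Q where "Q n \<delta> \<longleftrightarrow> gauge_on (J n) \<delta> \<and> (\<forall>\<pi>. M_partition_in (J n) \<pi> \<and> gauge_fine \<delta> \<pi> \<longrightarrow>
    norm (\<Sum>(t, I)\<in>\<pi>. measure lebesgue I *\<^sub>R h t - H I) \<le> \<epsilon> * (1/2) ^ (n + 2))" for n \<delta>
  have "\<exists>\<delta>. Q n \<delta>" for n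
    unfolding Q_def using \<open>\<epsilon> > 0\<close> by (intro Saks_Henstock [OF H J] int [THEN bspec] intervals_in_imp_UNIV) auto
  then obtain d where "\<And>n. Q n (d n)"
    by metis
  then have d: "\<And>n. gauge_on (J n) (d n)"
    "\<And>n \<pi>. M_partition_in (J n) \<pi> \<Longrightarrow> gauge_fine (d n) \<pi> \<Longrightarrow>
      norm (\<Sum>(t, I)\<in>\<pi>. measure lebesgue I *\<^sub>R h t - H I) \<le> \<epsilon> * (1/2) ^ (n + 2)"
    unfolding Q_def by blast+
  define \<nu> :: "real ^ 'm \<Rightarrow> nat" where "\<nu> t = nat \<lfloor>infnorm t\<rfloor>" for t
  have ball_J: "max_ball t 1 \<subseteq> J (\<nu> t)" for t
  proof
    fix s assume "s \<in> max_ball t 1"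
    then have s: "infnorm (s - t) < 1"
      by (simp add: max_ball_def)
    have t: "infnorm t < real (\<nu> t) + 1"
      unfolding \<nu>_def using infnorm_pos_le [of t] by linarith
    have "\<bar>s $ i\<bar> < real (\<nu> t) + 2" for i
      using component_le_infnorm_cart [of "s - t" i] component_le_infnorm_cart [of t i] s t by auto
    then have "- (real (\<nu> t) + 2) \<le> s $ i \<and> s $ i \<le> real (\<nu> t) + 2" for i
      by (smt (verit))
    then show "s \<in> J (\<nu> t)"
      by (simp add: J_def mem_box_cart)
  qed
  define \<delta> where "\<delta> t = min 1 (d (\<nu> t) t)" for t
  have t_J: "t \<in> J (\<nu> t)" for t
    using ball_J [of t] centre_in_max_ball [of 1 t] by auto
  have "gauge_on UNIV \<delta>"
    using d(1) t_J by (auto simp: gauge_on_def \<delta>_def)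
  moreover have "norm (\<Sum>(t, I)\<in>\<pi>. measure lebesgue I *\<^sub>R h t - H I) < \<epsilon>"
    if \<pi>: "M_partition_in UNIV \<pi>" "gauge_fine \<delta> \<pi>" for \<pi>
  proof -
    let ?g = "\<lambda>(t, I). measure lebesgue I *\<^sub>R h t - H I"
    let ?\<pi> = "\<lambda>n. {p \<in> \<pi>. \<nu> (fst p) = n}"
    have fin: "finite \<pi>"
      using \<pi>(1) by (simp add: M_partition_in_def)
    have "norm (sum ?g (?\<pi> n)) \<le> \<epsilon> * (1/2) ^ (n + 2)" for n
    proof (rule d(2))
      have "I \<subseteq> J n" "t \<in> J n" if tI: "(t, I) \<in> ?\<pi> n" for t I
      proof -
        have "I \<subseteq> max_ball t (\<delta> t)"
          using \<pi>(2) tI by (auto simp: gauge_fine_def)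
        also have "\<dots> \<subseteq> max_ball t 1"
          by (intro max_ball_mono) (simp add: \<delta>_def)
        also have "\<dots> \<subseteq> J n"
          using ball_J tI by auto
        finally show "I \<subseteq> J n" .
        show "t \<in> J n"
          using t_J tI by auto
      qed
      then show "M_partition_in (J n) (?\<pi> n)"
        using M_partition_in_restrict [OF M_partition_in_subset [OF \<pi>(1)], of "?\<pi> n" "J n"] by auto
      show "gauge_fine (d n) (?\<pi> n)"
        by (rule gauge_fine_mono [OF gauge_fine_subset [OF \<pi>(2)]]) (auto simp: \<delta>_def)
    qed
    then have "norm (sum ?g \<pi>) \<le> (\<Sum>n\<in>(\<lambda>p. \<nu> (fst p)) ` \<pi>. \<epsilon> * (1/2) ^ (n + 2))"
      unfolding sum_group_nat [OF fin, of ?g "\<lambda>p. \<nu> (fst p)"] by (intro sum_norm_le)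
    also have "\<dots> \<le> \<epsilon> / 2"
      using fin \<open>\<epsilon> > 0\<close> by (intro sum_geometric_le) auto
    finally show ?thesis
      using \<open>\<epsilon> > 0\<close> by simp
  qed
  ultimately show ?thesis
    by blast
qed

text \<open>The tags are sorted by the integer part of \<open>norm (f t)\<close>. Those of level
  \<open>n\<close> carry values of norm at most \<open>n + 1\<close>, and their intervals, which do
  not overlap, are kept inside an open set around \<open>N\<close> of measure below the share of
  that level divided by \<open>n + 1\<close>.\<close>

lemma null_tags:
  fixes f :: "real ^ 'm \<Rightarrow> 'x::real_normed_vector"
  assumes N: "N \<in> null_sets lebesgue" and "\<epsilon> > 0"
  shows "\<exists>\<delta>. gauge_on N \<delta> \<and> (\<forall>\<pi>. M_partition_in UNIV \<pi> \<and> tagged_in N \<pi> \<and> gauge_fine \<delta> \<pi> \<longrightarrow>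
    norm (\<Sum>(t, I)\<in>\<pi>. measure lebesgue I *\<^sub>R f t) < \<epsilon>)"
proof -
  define \<nu> where "\<nu> t = nat \<lfloor>norm (f t)\<rfloor>" for t
  have \<nu>: "norm (f t) \<le> real (\<nu> t) + 1" for t
    unfolding \<nu>_def using norm_ge_zero [of "f t"] by linarith
  have "\<exists>U. open U \<and> N \<subseteq> U \<and> U \<in> lmeasurable \<and> measure lebesgue U < \<epsilon> * (1/2) ^ (n + 2) / (n + 1)" for n :: nat
  proof -
    have e: "0 < \<epsilon> * (1/2) ^ (n + 2) / (n + 1)"
      using \<open>\<epsilon> > 0\<close> by simp
    have "N \<in> sets lebesgue"
      using N by auto
    then obtain U where U: "open U" "N \<subseteq> U" "U - N \<in> lmeasurable"
      "emeasure lebesgue (U - N) < ennreal (\<epsilon> * (1/2) ^ (n + 2) / (n + 1))"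
      using sets_lebesgue_outer_open e by metis
    have "U \<in> sets lebesgue"
      using U(1) by auto
    then have "emeasure lebesgue U = emeasure lebesgue (U - N)"
      using N by (simp add: emeasure_Diff_null_set)
    then have U': "emeasure lebesgue U < ennreal (\<epsilon> * (1/2) ^ (n + 2) / (n + 1))"
      using U(4) by simp
    then have "U \<in> lmeasurable"
      using \<open>U \<in> sets lebesgue\<close> by (intro fmeasurableI) (auto intro: less_trans simp: top.not_eq_extremum)
    then have "measure lebesgue U < \<epsilon> * (1/2) ^ (n + 2) / (n + 1)"
      using U' e by (simp add: emeasure_eq_measure2 ennreal_less_iff)
    then show ?thesis
      using U \<open>U \<in> lmeasurable\<close> by blast
  qed
  then obtain U where U: "\<And>n. open (U n)" "\<And>n. N \<subseteq> U n" "\<And>n. U n \<in> lmeasurable"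
    "\<And>n::nat. measure lebesgue (U n) < \<epsilon> * (1/2) ^ (n + 2) / (n + 1)"
    by metis
  have "\<exists>r>0. max_ball t r \<subseteq> U (\<nu> t)" if "t \<in> N" for t
  proof -
    have "t \<in> U (\<nu> t)"
      using U(2) that by blast
    then show ?thesis
      using open_contains_max_ball [OF U(1)] by metis
  qed
  then obtain \<delta> where \<delta>: "\<And>t. t \<in> N \<Longrightarrow> \<delta> t > 0" "\<And>t. t \<in> N \<Longrightarrow> max_ball t (\<delta> t) \<subseteq> U (\<nu> t)"
    by metis
  have "norm (\<Sum>(t, I)\<in>\<pi>. measure lebesgue I *\<^sub>R f t) < \<epsilon>"
    if \<pi>: "M_partition_in UNIV \<pi>" "tagged_in N \<pi>" "gauge_fine \<delta> \<pi>" for \<pi>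
  proof -
    let ?\<pi> = "\<lambda>n. {p \<in> \<pi>. \<nu> (fst p) = n}"
    let ?g = "\<lambda>(t, I). measure lebesgue I *\<^sub>R f t"
    have fin: "finite \<pi>"
      using \<pi>(1) by (simp add: M_partition_in_def)
    have "norm (sum ?g (?\<pi> n)) \<le> \<epsilon> * (1/2) ^ (n + 2)" for n
    proof -
      have sub: "snd p \<subseteq> U n" "snd p \<in> intervals_in UNIV" if p: "p \<in> ?\<pi> n" for p
      proof -
        have "fst p \<in> N"
          using \<pi>(2) p by (auto simp: tagged_in_def)
        moreover have "snd p \<subseteq> max_ball (fst p) (\<delta> (fst p))"
          using gauge_fineD [OF \<pi>(3), of "fst p" "snd p"] p by simp
        ultimately show "snd p \<subseteq> U n"
          using \<delta>(2) p by blast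
        show "snd p \<in> intervals_in UNIV"
          using \<pi>(1) p by (auto simp: M_partition_in_def)
      qed
      have "norm (sum ?g (?\<pi> n)) \<le> (\<Sum>p\<in>?\<pi> n. measure lebesgue (snd p) * (real n + 1))"
        using \<nu> by (intro sum_norm_le) (auto intro!: mult_left_mono)
      also have "\<dots> = (\<Sum>p\<in>?\<pi> n. measure lebesgue (snd p)) * (real n + 1)"
        by (simp add: sum_distrib_right)
      also have "\<dots> \<le> measure lebesgue (U n) * (real n + 1)"
        using sub fin U(3) \<pi>(1)
        by (intro mult_right_mono sum_measure_nonoverlapping_le) (auto simp: M_partition_in_def)
      also have "\<dots> \<le> \<epsilon> * (1/2) ^ (n + 2)"
        using U(4) [of n] by (simp add: pos_less_divide_eq algebra_simps)
      finally show ?thesis .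
    qed
    then have "norm (sum ?g \<pi>) \<le> (\<Sum>n\<in>(\<lambda>p. \<nu> (fst p)) ` \<pi>. \<epsilon> * (1/2) ^ (n + 2))"
      unfolding sum_group_nat [OF fin, of ?g "\<lambda>p. \<nu> (fst p)"] by (intro sum_norm_le)
    also have "\<dots> \<le> \<epsilon> / 2"
      using fin \<open>\<epsilon> > 0\<close> by (intro sum_geometric_le) auto
    finally show ?thesis
      using \<open>\<epsilon> > 0\<close> by simp
  qed
  moreover have "gauge_on N \<delta>"
    using \<delta>(1) by (simp add: gauge_on_def)
  ultimately show ?thesis
    by blast
qed

section \<open>Absolute continuity of the primitive\<close>

text \<open>What is left after the flat intersections are removed still covers \<open>K\<close>;
  over these pieces an additive interval function can be summed.\<close>

lemma M_partition_of_Int_division: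
  fixes J :: "(real ^ 'm) set"
  assumes \<pi>: "M_partition_of J \<pi>" and K: "K \<in> intervals_in J"
  shows "(\<lambda>p. K \<inter> snd p) ` {p \<in> \<pi>. interior (K \<inter> snd p) \<noteq> {}} division_of K"
proof -
  have \<pi>': "M_partition_in J \<pi>" "\<Union>(snd ` \<pi>) = J"
    using \<pi> by (auto simp: M_partition_of_def case_prod_unfold)
  obtain a b where ab: "K = cbox a b" "interior K \<noteq> {}" "K \<subseteq> J"
    using K by (rule intervals_inE)
  have "{K} division_of K"
  proof -
    have "K \<noteq> {}"
      using ab(2) by auto
    then show ?thesis
      using ab(1) division_of_self by metis
  qed
  moreover have "snd ` \<pi> division_of J"
    using M_partition_in_division [OF \<pi>'(1)] \<pi>'(2) by simp
  ultimately have "{k1 \<inter> k2 | k1 k2. k1 \<in> {K} \<and> k2 \<in> snd ` \<pi> \<and> k1 \<inter> k2 \<noteq> {}} division_of (K \<inter> J)"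
    by (rule division_inter)
  moreover have "{k1 \<inter> k2 | k1 k2. k1 \<in> {K} \<and> k2 \<in> snd ` \<pi> \<and> k1 \<inter> k2 \<noteq> {}} =
      (\<lambda>p. K \<inter> snd p) ` {p \<in> \<pi>. K \<inter> snd p \<noteq> {}}"
    by auto
  ultimately have D: "(\<lambda>p. K \<inter> snd p) ` {p \<in> \<pi>. K \<inter> snd p \<noteq> {}} division_of cbox a b" (is "?D division_of _")
    using ab(1,3) by (simp add: Int_absorb2)
  have "measure lborel (cbox a b) \<noteq> 0"
    using ab content_eq_0_interior by metis
  then have "{k. k \<in> ?D \<and> measure lborel k \<noteq> 0} division_of K"
    using division_of_nontrivial [OF D] ab(1) by simp
  moreover have "{k. k \<in> ?D \<and> measure lborel k \<noteq> 0} = (\<lambda>p. K \<inter> snd p) ` {p \<in> \<pi>. interior (K \<inter> snd p) \<noteq> {}}"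
  proof -
    have eq: "measure lborel (K \<inter> snd p) \<noteq> 0 \<longleftrightarrow> interior (K \<inter> snd p) \<noteq> {}" if "p \<in> \<pi>" for p
    proof -
      have "snd p \<in> intervals_in J"
        using \<pi>'(1) that by (auto simp: M_partition_in_def)
      then obtain c d where "snd p = cbox c d"
        by (rule intervals_inE)
      then obtain u v where uv: "K \<inter> snd p = cbox u v"
        using ab(1) cbox_Int_cbox by metis
      show ?thesis
        unfolding uv using content_eq_0_interior [of u v] by (simp only: simp_thms)
    qed
    show ?thesis
    proof (intro set_eqI iffI)
      fix k assume "k \<in> {k. k \<in> ?D \<and> measure lborel k \<noteq> 0}"
      then obtain p where p: "p \<in> \<pi>" "k = K \<inter> snd p" "measure lborel k \<noteq> 0"
        by blast
      then have "interior (K \<inter> snd p) \<noteq> {}"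
        using eq by metis
      then show "k \<in> (\<lambda>p. K \<inter> snd p) ` {p \<in> \<pi>. interior (K \<inter> snd p) \<noteq> {}}"
        using p by blast
    next
      fix k assume "k \<in> (\<lambda>p. K \<inter> snd p) ` {p \<in> \<pi>. interior (K \<inter> snd p) \<noteq> {}}"
      then obtain p where p: "p \<in> \<pi>" "k = K \<inter> snd p" "interior (K \<inter> snd p) \<noteq> {}"
        by blast
      moreover have "K \<inter> snd p \<noteq> {}"
        using p(3) interior_empty by metis
      ultimately show "k \<in> {k. k \<in> ?D \<and> measure lborel k \<noteq> 0}"
        using eq by blast
    qed
  qed
  ultimately show ?thesis
    by simp
qed

text \<open>Intersecting the members of one fixed fine partition with the given intervals keeps its
  finitely many tags, on which \<open>h\<close> is bounded.\<close>

lemma interval_function_absolutely_continuous: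
  fixes h :: "real ^ 'm \<Rightarrow> 'x::real_normed_vector"
  assumes H: "additive_interval_function UNIV H" and J: "J \<in> intervals_in UNIV"
    and int: "\<And>K. K \<in> intervals_in J \<Longrightarrow> has_McShane_integral h (H K) K"
    and "\<epsilon> > 0"
  obtains \<eta> where "\<eta> > 0" "\<And>A (K :: 'i \<Rightarrow> _). finite A \<Longrightarrow> (\<And>x. x \<in> A \<Longrightarrow> K x \<in> intervals_in J) \<Longrightarrow>
    (\<And>x y. x \<in> A \<Longrightarrow> y \<in> A \<Longrightarrow> x \<noteq> y \<Longrightarrow> nonoverlapping (K x) (K y)) \<Longrightarrow>
    (\<Sum>x\<in>A. measure lebesgue (K x)) < \<eta> \<Longrightarrow> norm (\<Sum>x\<in>A. H (K x)) < \<epsilon>"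
proof -
  have "\<exists>\<delta>. gauge_on J \<delta> \<and> (\<forall>\<pi>. M_partition_in J \<pi> \<and> gauge_fine \<delta> \<pi> \<longrightarrow>
      norm (\<Sum>(t, I)\<in>\<pi>. measure lebesgue I *\<^sub>R h t - H I) \<le> \<epsilon> / 2)"
    using \<open>\<epsilon> > 0\<close> by (intro Saks_Henstock [OF H J] int) auto
  then obtain \<delta> where \<delta>: "gauge_on J \<delta>"
    "\<And>\<pi>. M_partition_in J \<pi> \<Longrightarrow> gauge_fine \<delta> \<pi> \<Longrightarrow>
      norm (\<Sum>(t, I)\<in>\<pi>. measure lebesgue I *\<^sub>R h t - H I) \<le> \<epsilon> / 2"
    by blast
  obtain \<pi> where \<pi>: "M_partition_of J \<pi>" "gauge_fine \<delta> \<pi>"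
    using fine_M_partition_exists [OF J \<delta>(1)] .
  have \<pi>_in: "M_partition_in J \<pi>"
    using \<pi>(1) by (simp add: M_partition_of_def)
  then have fin: "finite \<pi>" and
    \<pi>D: "\<And>p. p \<in> \<pi> \<Longrightarrow> fst p \<in> J" "\<And>p. p \<in> \<pi> \<Longrightarrow> snd p \<in> intervals_in J"
      "\<And>p q. p \<in> \<pi> \<Longrightarrow> q \<in> \<pi> \<Longrightarrow> p \<noteq> q \<Longrightarrow> nonoverlapping (snd p) (snd q)"
    by (auto simp: M_partition_in_def case_prod_unfold)
  \<comment> \<open>The summand 1 keeps \<open>M\<close> positive even if \<open>h\<close> vanishes
    at all tags.\<close>
  define M where "M = 1 + (\<Sum>p\<in>\<pi>. norm (h (fst p)))"
  have M: "M > 0" "\<And>p. p \<in> \<pi> \<Longrightarrow> norm (h (fst p)) \<le> M"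
  proof -
    show "M > 0"
      unfolding M_def by (intro add_pos_nonneg sum_nonneg) auto
    show "norm (h (fst p)) \<le> M" if "p \<in> \<pi>" for p
      using member_le_sum [OF that, of "\<lambda>p. norm (h (fst p))"] fin by (simp add: M_def)
  qed
  show thesis
  proof
    \<comment> \<open>Half of \<open>\<epsilon>\<close> pays for the Saks-Henstock error, the other
      half for the Riemann sum, whose norm is at most \<open>M\<close> times the total
      measure.\<close>
    show "\<epsilon> / (2 * M) > 0"
      using M \<open>\<epsilon> > 0\<close> by simp
    fix A and K :: "'i \<Rightarrow> (real ^ 'm) set"
    assume A: "finite A" and K: "\<And>x. x \<in> A \<Longrightarrow> K x \<in> intervals_in J"
      and no: "\<And>x y. x \<in> A \<Longrightarrow> y \<in> A \<Longrightarrow> x \<noteq> y \<Longrightarrow> nonoverlapping (K x) (K y)"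
      and small: "(\<Sum>x\<in>A. measure lebesgue (K x)) < \<epsilon> / (2 * M)"
    define B where "B x = {p \<in> \<pi>. interior (K x \<inter> snd p) \<noteq> {}}" for x
    define S where "S = (SIGMA x:A. B x)"
    have finB: "finite (B x)" for x
      using fin by (simp add: B_def)
    have finS: "finite S"
      using A finB by (simp add: S_def)
    have KL: "K x \<inter> snd p \<in> intervals_in J" if "x \<in> A" "p \<in> B x" for x p
      using Int_intervals_in [OF intervals_in_imp_UNIV [OF K [OF that(1)]] \<pi>D(2) [of p]] that(2)
      by (simp add: B_def)
    have no_S: "nonoverlapping (K x \<inter> snd p) (K y \<inter> snd q)"
      if "(x, p) \<in> S" "(y, q) \<in> S" "(x, p) \<noteq> (y, q)" for x p y q
    proof (cases "x = y")
      case True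
      then have "nonoverlapping (snd p) (snd q)"
        using \<pi>D(3) that by (auto simp: S_def B_def)
      then show ?thesis
        by (rule nonoverlapping_mono) auto
    next
      case False
      then have "nonoverlapping (K x) (K y)"
        using no that by (auto simp: S_def)
      then show ?thesis
        by (rule nonoverlapping_mono) auto
    qed
    \<comment> \<open>A piece of \<open>snd p\<close> still lies in the max ball around
      \<open>fst p\<close>, so fineness is inherited; the tag may lie outside the piece, as
      M-partitions allow.\<close>
    define \<tau> where "\<tau> = (\<lambda>(x, p :: (real ^ 'm) \<times> (real ^ 'm) set). (fst p, K x \<inter> snd p))"
    have \<tau>_snd: "snd (\<tau> z) = K (fst z) \<inter> snd (snd z)" "fst (\<tau> z) = fst (snd z)" for z
      by (simp_all add: \<tau>_def case_prod_unfold)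
    have inj: "inj_on \<tau> S"
    proof (rule inj_onI)
      fix z w assume zw: "z \<in> S" "w \<in> S" "\<tau> z = \<tau> w"
      show "z = w"
      proof (rule ccontr)
        assume "z \<noteq> w"
        then have "nonoverlapping (snd (\<tau> z)) (snd (\<tau> w))"
          using no_S [of "fst z" "snd z" "fst w" "snd w"] zw(1,2) unfolding \<tau>_snd by simp
        moreover have "snd (\<tau> z) \<in> intervals_in J"
          using KL [of "fst z" "snd z"] zw(1) unfolding \<tau>_snd S_def by auto
        ultimately show False
          using nonoverlapping_self_interval zw(3) by metis
      qed
    qed
    have "M_partition_in J (\<tau> ` S)"
      unfolding M_partition_in_def
    proof (intro conjI ballI impI)
      show "finite (\<tau> ` S)"
        using finS by simp
      fix r assume "r \<in> \<tau> ` S"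
      then obtain x p where xp: "x \<in> A" "p \<in> B x" "r = (fst p, K x \<inter> snd p)"
        by (auto simp: S_def \<tau>_def)
      show "case r of (t, I) \<Rightarrow> t \<in> J \<and> I \<in> intervals_in J"
        using KL [OF xp(1,2)] \<pi>D(1) xp by (simp add: B_def)
    next
      fix r s assume "r \<in> \<tau> ` S" "s \<in> \<tau> ` S" "r \<noteq> s"
      then obtain z w where "z \<in> S" "w \<in> S" "z \<noteq> w" "r = \<tau> z" "s = \<tau> w"
        by blast
      then show "nonoverlapping (snd r) (snd s)"
        using no_S [of "fst z" "snd z" "fst w" "snd w"] by (simp add: \<tau>_snd)
    qed
    moreover have "gauge_fine \<delta> (\<tau> ` S)"
    proof (rule gauge_fineI)
      fix t I assume "(t, I) \<in> \<tau> ` S"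
      then obtain x p where xp: "x \<in> A" "p \<in> B x" "t = fst p" "I = K x \<inter> snd p"
        by (auto simp: S_def \<tau>_def)
      have "(fst p, snd p) \<in> \<pi>"
        using xp(2) by (simp add: B_def)
      then show "I \<subseteq> max_ball t (\<delta> t)"
        using gauge_fineD [OF \<pi>(2)] xp(3,4) by blast
    qed
    ultimately have "norm (\<Sum>(t, I)\<in>\<tau> ` S. measure lebesgue I *\<^sub>R h t - H I) \<le> \<epsilon> / 2"
      by (rule \<delta>(2))
    then have 1: "norm (\<Sum>(x, p)\<in>S. measure lebesgue (K x \<inter> snd p) *\<^sub>R h (fst p) - H (K x \<inter> snd p)) \<le> \<epsilon> / 2"
      using sum.reindex [OF inj, of "\<lambda>(t, I). measure lebesgue I *\<^sub>R h t - H I"]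
      by (simp add: \<tau>_snd case_prod_unfold)
    have "norm (\<Sum>(x, p)\<in>S. measure lebesgue (K x \<inter> snd p) *\<^sub>R h (fst p))
        \<le> (\<Sum>z\<in>S. measure lebesgue (K (fst z) \<inter> snd (snd z)) * M)"
      using M(2) by (intro sum_norm_le) (auto intro!: mult_left_mono simp: S_def B_def)
    also have "\<dots> = (\<Sum>x\<in>A. \<Sum>p\<in>B x. measure lebesgue (K x \<inter> snd p)) * M"
      using A finB by (simp add: S_def sum.Sigma sum_distrib_right case_prod_unfold)
    also have "\<dots> \<le> (\<Sum>x\<in>A. measure lebesgue (K x)) * M"
    proof (intro mult_right_mono sum_mono)
      fix x assume x: "x \<in> A"
      show "(\<Sum>p\<in>B x. measure lebesgue (K x \<inter> snd p)) \<le> measure lebesgue (K x)"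
      proof (rule sum_measure_nonoverlapping_le)
        show "K x \<in> lmeasurable"
          using K [OF x] by (rule interval_lmeasurable)
        show "K x \<inter> snd p \<in> intervals_in J" if "p \<in> B x" for p
          by (rule KL [OF x that])
        show "nonoverlapping (K x \<inter> snd p) (K x \<inter> snd q)" if "p \<in> B x" "q \<in> B x" "p \<noteq> q" for p q
          using no_S [of x p x q] x that by (simp add: S_def)
      qed (use finB in auto)
    qed (use M in auto)
    also have "\<dots> < \<epsilon> / (2 * M) * M"
      using small M(1) by (intro mult_strict_right_mono)
    also have "\<dots> = \<epsilon> / 2"
      using M(1) by simp
    finally have 2: "norm (\<Sum>(x, p)\<in>S. measure lebesgue (K x \<inter> snd p) *\<^sub>R h (fst p)) < \<epsilon> / 2" .
    have "H (K x) = (\<Sum>p\<in>B x. H (K x \<inter> snd p))" if x: "x \<in> A" for x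
    proof -
      have inj_x: "inj_on (\<lambda>p. K x \<inter> snd p) (B x)"
      proof (rule inj_onI)
        fix p q assume pq: "p \<in> B x" "q \<in> B x" "K x \<inter> snd p = K x \<inter> snd q"
        show "p = q"
        proof (rule ccontr)
          assume "p \<noteq> q"
          then have "nonoverlapping (K x \<inter> snd p) (K x \<inter> snd q)"
            using no_S [of x p x q] x pq by (simp add: S_def)
          then show False
            using nonoverlapping_self_interval KL [OF x pq(1)] pq(3) by metis
        qed
      qed
      have "H (K x) = (\<Sum>L\<in>(\<lambda>p. K x \<inter> snd p) ` B x. H L)"
      proof (rule additive_interval_function_division [OF H])
        show "K x \<in> intervals_in UNIV"
          using K [OF x] by (rule intervals_in_imp_UNIV)
        show "(\<lambda>p. K x \<inter> snd p) ` B x division_of K x"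
          unfolding B_def by (rule M_partition_of_Int_division [OF \<pi>(1) K [OF x]])
      qed (auto simp: B_def)
      then show ?thesis
        by (simp add: sum.reindex [OF inj_x])
    qed
    then have "(\<Sum>x\<in>A. H (K x)) = (\<Sum>x\<in>A. \<Sum>p\<in>B x. H (K x \<inter> snd p))"
      by simp
    also have "\<dots> = (\<Sum>(x, p)\<in>S. H (K x \<inter> snd p))"
      using A finB by (simp add: S_def sum.Sigma)
    also have "\<dots> = (\<Sum>(x, p)\<in>S. measure lebesgue (K x \<inter> snd p) *\<^sub>R h (fst p)) -
        (\<Sum>(x, p)\<in>S. measure lebesgue (K x \<inter> snd p) *\<^sub>R h (fst p) - H (K x \<inter> snd p))"
      by (simp add: case_prod_unfold sum_subtractf)
    finally have eq: "(\<Sum>x\<in>A. H (K x)) = \<dots>" .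
    show "norm (\<Sum>x\<in>A. H (K x)) < \<epsilon>"
      unfolding eq using 1 2 by (intro le_less_trans [OF norm_triangle_ineq4]) linarith
  qed
qed

text \<open>The Cauchy criterion for the net of finite sums: two finite sets containing
  \<open>S\<close> have sums within half the tolerance of \<open>sum a S\<close>, and completeness
  gives the limit. The hypothesis bounds norms of sums rather than sums of norms, since vector
  series may converge unconditionally without converging absolutely.\<close>

lemma summable_on_vanishing_tails:
  fixes a :: "'i \<Rightarrow> 'x::banach"
  assumes "\<And>\<epsilon>. \<epsilon> > 0 \<Longrightarrow> \<exists>S. finite S \<and> S \<subseteq> A \<and> (\<forall>T. finite T \<and> T \<subseteq> A \<and> T \<inter> S = {} \<longrightarrow> norm (sum a T) < \<epsilon>)"
  shows "a summable_on A"
proof -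
  let ?F = "filtermap (sum a) (finite_subsets_at_top A)"
  have "cauchy_filter ?F"
  proof (rule cauchy_filter_metric_filtermap [THEN iffD2], intro allI impI)
    fix e :: real assume "e > 0"
    then have "e / 2 > 0"
      by simp
    from assms [OF this] obtain S where "finite S \<and> S \<subseteq> A \<and>
        (\<forall>T. finite T \<and> T \<subseteq> A \<and> T \<inter> S = {} \<longrightarrow> norm (sum a T) < e / 2)" ..
    then have S: "finite S" "S \<subseteq> A"
      "\<And>T. finite T \<Longrightarrow> T \<subseteq> A \<Longrightarrow> T \<inter> S = {} \<Longrightarrow> norm (sum a T) < e / 2"
      by simp_all
    define P where "P T \<longleftrightarrow> finite T \<and> S \<subseteq> T \<and> T \<subseteq> A" for T
    have "eventually P (finite_subsets_at_top A)"
      unfolding eventually_finite_subsets_at_top P_def using S by blast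
    moreover have "dist (sum a T) (sum a T') < e" if "P T" "P T'" for T T'
    proof -
      have *: "norm (sum a T - sum a S) < e / 2" if "P T" for T
      proof -
        have "sum a T - sum a S = sum a (T - S)"
          using that S(1) by (simp add: P_def sum_diff)
        then show ?thesis
          using S(3) [of "T - S"] that by (auto simp: P_def)
      qed
      show ?thesis
        using * [OF that(1)] * [OF that(2)] norm_triangle_ineq4 [of "sum a T - sum a S" "sum a T' - sum a S"]
        by (simp add: dist_norm)
    qed
    ultimately show "\<exists>P. eventually P (finite_subsets_at_top A) \<and>
        (\<forall>x y. P x \<and> P y \<longrightarrow> dist (sum a x) (sum a y) < e)"
      by blast
  qed
  then obtain x where "?F \<le> nhds x"
    using cauchy_filter_complete_converges [of ?F UNIV]
    by (auto simp: filtermap_bot_iff complete_UNIV)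
  then show ?thesis
    by (auto simp: summable_on_def has_sum_def filterlim_def)
qed

section \<open>Whitney divisions\<close>

definition dyadic_cube :: "nat \<Rightarrow> ('m::finite \<Rightarrow> int) \<Rightarrow> (real ^ 'm) set" where
  "dyadic_cube n z = cbox (\<chi> i. z i / 2 ^ n) (\<chi> i. (z i + 1) / 2 ^ n)"

text \<open>The cube together with its neighbours of the same level. A cube whose collar lies in
  \<open>U\<close> keeps a max-norm distance of at least its side from the complement, as Whitney
  cubes should.\<close>

definition dyadic_collar :: "nat \<Rightarrow> ('m::finite \<Rightarrow> int) \<Rightarrow> (real ^ 'm) set" where
  "dyadic_collar n z = cbox (\<chi> i. (z i - 1) / 2 ^ n) (\<chi> i. (z i + 2) / 2 ^ n)"

text \<open>Collars are nested, so testing the parent alone singles out the maximal cubes, among those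
  of side at most 1, whose collar lies in \<open>U\<close>.\<close>

definition whitney :: "(real ^ 'm) set \<Rightarrow> (nat \<times> ('m \<Rightarrow> int)) set" where
  "whitney U = {(n, z). dyadic_collar n z \<subseteq> U \<and>
     (n = 0 \<or> \<not> dyadic_collar (n - 1) (\<lambda>i. z i div 2) \<subseteq> U)}"

section \<open>Nesting of dyadic cubes and their collars\<close>

lemma mem_dyadic_cube:
  "x \<in> dyadic_cube n z \<longleftrightarrow> (\<forall>i. real_of_int (z i) \<le> 2 ^ n * x $ i \<and> 2 ^ n * x $ i \<le> real_of_int (z i) + 1)"
  by (simp add: dyadic_cube_def mem_box_cart field_simps)

lemma mem_interior_dyadic_cube:
  "x \<in> interior (dyadic_cube n z) \<longleftrightarrow> (\<forall>i. real_of_int (z i) < 2 ^ n * x $ i \<and> 2 ^ n * x $ i < real_of_int (z i) + 1)"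
  by (simp add: dyadic_cube_def mem_box_cart field_simps)

lemma mem_dyadic_collar:
  "x \<in> dyadic_collar n z \<longleftrightarrow> (\<forall>i. real_of_int (z i) - 1 \<le> 2 ^ n * x $ i \<and> 2 ^ n * x $ i \<le> real_of_int (z i) + 2)"
  by (simp add: dyadic_collar_def mem_box_cart field_simps)

lemma dyadic_cube_interval: "dyadic_cube n z \<subseteq> E \<Longrightarrow> dyadic_cube n z \<in> intervals_in E"
  unfolding dyadic_cube_def by (rule cbox_in_intervals) (auto simp: divide_strict_right_mono)

lemma dyadic_cube_subset_collar: "dyadic_cube n z \<subseteq> dyadic_collar n z"
proof
  fix x assume x: "x \<in> dyadic_cube n z"
  have "real_of_int (z i) - 1 \<le> 2 ^ n * x $ i \<and> 2 ^ n * x $ i \<le> real_of_int (z i) + 2" for i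
    using x [unfolded mem_dyadic_cube, THEN spec, of i] by linarith
  then show "x \<in> dyadic_collar n z"
    by (simp add: mem_dyadic_collar)
qed

lemma dyadic_parent_bounds: "2 * real_of_int (z div 2) \<le> real_of_int z" "real_of_int z \<le> 2 * real_of_int (z div 2) + 1"
proof -
  have "2 * (z div 2) \<le> z" "z \<le> 2 * (z div 2) + 1"
    by presburger+
  then show "2 * real_of_int (z div 2) \<le> real_of_int z" "real_of_int z \<le> 2 * real_of_int (z div 2) + 1"
    by linarith+
qed

lemma dyadic_cube_subset_parent: "dyadic_cube (Suc n) z \<subseteq> dyadic_cube n (\<lambda>i. z i div 2)"
proof
  fix x assume x: "x \<in> dyadic_cube (Suc n) z"
  have "real_of_int (z i div 2) \<le> 2 ^ n * x $ i \<and> 2 ^ n * x $ i \<le> real_of_int (z i div 2) + 1" for i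
  proof -
    have "real_of_int (z i) \<le> 2 * (2 ^ n * x $ i)" "2 * (2 ^ n * x $ i) \<le> real_of_int (z i) + 1"
      using x by (auto simp: mem_dyadic_cube mult.assoc)
    then show ?thesis
      using dyadic_parent_bounds [of "z i"] by linarith
  qed
  then show "x \<in> dyadic_cube n (\<lambda>i. z i div 2)"
    by (simp add: mem_dyadic_cube)
qed

lemma dyadic_collar_subset_parent: "dyadic_collar (Suc n) z \<subseteq> dyadic_collar n (\<lambda>i. z i div 2)"
proof
  fix x assume x: "x \<in> dyadic_collar (Suc n) z"
  have "real_of_int (z i div 2) - 1 \<le> 2 ^ n * x $ i \<and> 2 ^ n * x $ i \<le> real_of_int (z i div 2) + 2" for i
  proof -
    have "real_of_int (z i) - 1 \<le> 2 * (2 ^ n * x $ i)" "2 * (2 ^ n * x $ i) \<le> real_of_int (z i) + 2"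
      using x by (auto simp: mem_dyadic_collar mult.assoc)
    then show ?thesis
      using dyadic_parent_bounds [of "z i"] by linarith
  qed
  then show "x \<in> dyadic_collar n (\<lambda>i. z i div 2)"
    by (simp add: mem_dyadic_collar)
qed

lemma dyadic_collar_subset_ancestor: "dyadic_collar (n + k) z \<subseteq> dyadic_collar n (\<lambda>i. z i div 2 ^ k)"
proof (induction k arbitrary: z)
  case (Suc k)
  have "dyadic_collar (Suc (n + k)) z \<subseteq> dyadic_collar (n + k) (\<lambda>i. z i div 2)"
    by (rule dyadic_collar_subset_parent)
  also have "\<dots> \<subseteq> dyadic_collar n (\<lambda>i. z i div 2 div 2 ^ k)"
    by (rule Suc.IH)
  finally show ?case
    by (simp add: zdiv_zmult2_eq)
qed simp

text \<open>Climb from the cube to its ancestors as long as their collars stay in \<open>U\<close>.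
  The climb ends at a maximal cube, at level 0 at the latest.\<close>

lemma whitney_contains:
  assumes "dyadic_collar n z \<subseteq> U"
  shows "\<exists>m w. (m, w) \<in> whitney U \<and> dyadic_cube n z \<subseteq> dyadic_cube m w"
  using assms
proof (induction n arbitrary: z)
  case 0
  then have "(0, z) \<in> whitney U"
    by (simp add: whitney_def)
  then show ?case by blast
next
  case (Suc n)
  show ?case
  proof (cases "dyadic_collar n (\<lambda>i. z i div 2) \<subseteq> U")
    case True
    then show ?thesis
      using Suc.IH [OF True] order_trans [OF dyadic_cube_subset_parent] by blast
  next
    case False
    then have "(Suc n, z) \<in> whitney U"
      using Suc.prems by (simp add: whitney_def)
    then show ?thesis by blast
  qed
qed

text \<open>Dyadic cubes with a common interior point are nested. If \<open>m\<close> exceeded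
  \<open>n\<close>, the collar of the parent of \<open>(m, w)\<close> would lie in the collar of
  \<open>(n, z)\<close>, hence in \<open>U\<close>, against the parent test for
  \<open>(m, w)\<close>.\<close>

lemma whitney_level_le:
  assumes "(n, z) \<in> whitney U" "(m, w) \<in> whitney U"
    and x: "x \<in> interior (dyadic_cube n z)" "x \<in> interior (dyadic_cube m w)"
  shows "m \<le> n"
proof (rule ccontr)
  assume "\<not> m \<le> n"
  then obtain k where m: "m = Suc (n + k)"
    using less_imp_Suc_add by (metis not_le)
  \<comment> \<open>An interior point determines the index of its cube by rounding down, so the
    indices of nested cubes are related by integer division.\<close>
  have z: "z i = \<lfloor>2 ^ n * x $ i\<rfloor>" and w: "w i = \<lfloor>2 ^ m * x $ i\<rfloor>" for i
    using x by (auto simp: mem_interior_dyadic_cube less_imp_le intro!: floor_unique [symmetric])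
  have "z i = (w i div 2) div 2 ^ k" for i
  proof -
    have "2 ^ n * x $ i = (2 ^ m * x $ i) / real_of_int (2 * 2 ^ k)"
      by (simp add: m power_add)
    then have "z i = w i div (2 * 2 ^ k)"
      unfolding z w using floor_divide_real_eq_div [of "2 * 2 ^ k"] by simp
    then show ?thesis
      by (simp add: zdiv_zmult2_eq)
  qed
  then have "z = (\<lambda>i. w i div 2 div 2 ^ k)"
    by blast
  then have "dyadic_collar (n + k) (\<lambda>i. w i div 2) \<subseteq> U"
    using dyadic_collar_subset_ancestor [of n k "\<lambda>i. w i div 2"] assms(1) by (auto simp: whitney_def)
  then show False
    using assms(2) m by (simp add: whitney_def)
qed

lemma whitney_nonoverlapping:
  assumes "(n, z) \<in> whitney U" "(m, w) \<in> whitney U" "(n, z) \<noteq> (m, w)"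
  shows "nonoverlapping (dyadic_cube n z) (dyadic_cube m w)"
proof (rule ccontr)
  assume "\<not> nonoverlapping (dyadic_cube n z) (dyadic_cube m w)"
  then obtain x where x: "x \<in> interior (dyadic_cube n z)" "x \<in> interior (dyadic_cube m w)"
    by (auto simp: nonoverlapping_def)
  then have "n = m"
    using whitney_level_le assms(1,2) by (meson order_antisym)
  moreover have "z i = \<lfloor>2 ^ n * x $ i\<rfloor>" "w i = \<lfloor>2 ^ m * x $ i\<rfloor>" for i
    using x by (auto simp: mem_interior_dyadic_cube less_imp_le intro!: floor_unique [symmetric])
  ultimately show False
    using assms(3) by auto
qed

text \<open>One level serves all closed cubes through \<open>x\<close>, of which there are several
  if \<open>x\<close> lies on a face. This leaves the choice of the cube free for
  \<open>dyadic_cube_in_direction\<close>.\<close>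

lemma small_dyadic_collar:
  fixes x :: "real ^ 'm"
  assumes "open U" "x \<in> U"
  shows "\<exists>n. \<forall>z. x \<in> dyadic_cube n z \<longrightarrow> dyadic_collar n z \<subseteq> U"
proof -
  obtain e where e: "e > 0" "ball x e \<subseteq> U"
    using assms by (auto simp: open_contains_ball)
  \<comment> \<open>A point of the collar differs from \<open>x\<close> by at most two sides in each
    coordinate; summing over the coordinates bounds the Euclidean distance by \<open>c\<close>
    sides.\<close>
  define c where "c = 2 * real CARD('m)"
  obtain n where n: "(1/2) ^ n < e / c"
    using real_arch_pow_inv [of "e / c" "1/2"] e by (auto simp: c_def)
  have "dyadic_collar n z \<subseteq> U" if x: "x \<in> dyadic_cube n z" for z
  proof
    fix y assume y: "y \<in> dyadic_collar n z"
    have "\<bar>(y - x) $ i\<bar> \<le> 2 * (1/2) ^ n" for i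
    proof -
      have "real_of_int (z i) \<le> 2 ^ n * x $ i" "2 ^ n * x $ i \<le> real_of_int (z i) + 1"
        "real_of_int (z i) - 1 \<le> 2 ^ n * y $ i" "2 ^ n * y $ i \<le> real_of_int (z i) + 2"
        using x y by (auto simp: mem_dyadic_cube mem_dyadic_collar)
      then have "\<bar>2 ^ n * (y $ i - x $ i)\<bar> \<le> 2"
        unfolding right_diff_distrib by linarith
      then have "2 ^ n * \<bar>y $ i - x $ i\<bar> \<le> 2"
        by (simp add: abs_mult)
      then show ?thesis
        by (simp add: power_divide pos_le_divide_eq mult.commute)
    qed
    then have "norm (y - x) \<le> (\<Sum>i\<in>(UNIV :: 'm set). 2 * (1/2) ^ n)"
      by (intro order_trans [OF norm_le_l1_cart] sum_mono)
    also have "\<dots> = c * (1/2) ^ n"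
      by (simp add: c_def)
    also have "\<dots> < e"
      using n by (simp add: c_def field_simps)
    finally show "y \<in> U"
      using e(2) by (auto simp: dist_norm norm_minus_commute)
  qed
  then show ?thesis
    by blast
qed

lemma dyadic_cube_in_direction:
  fixes x d :: "real ^ 'm"
  shows "\<exists>z. x \<in> dyadic_cube n z \<and> (\<forall>\<^sub>F s in at_right 0. x + s *\<^sub>R d \<in> dyadic_cube n z)"
proof (intro exI conjI)
  \<comment> \<open>Round down in the coordinates where the segment does not decrease. Where it
    decreases, the ceiling minus one picks the lower cube when \<open>x\<close> sits on a
    face.\<close>
  define z where "z i = (if d $ i \<ge> 0 then \<lfloor>2 ^ n * x $ i\<rfloor> else \<lceil>2 ^ n * x $ i\<rceil> - 1)" for i
  have z: "real_of_int (z i) \<le> 2 ^ n * x $ i" "2 ^ n * x $ i \<le> real_of_int (z i) + 1"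
    "d $ i \<ge> 0 \<Longrightarrow> 2 ^ n * x $ i < real_of_int (z i) + 1" "\<not> d $ i \<ge> 0 \<Longrightarrow> real_of_int (z i) < 2 ^ n * x $ i" for i
    unfolding z_def by (auto split: if_splits) linarith+
  show "x \<in> dyadic_cube n z"
    using z(1,2) by (simp add: mem_dyadic_cube)
  have "\<forall>\<^sub>F s in at_right 0. real_of_int (z i) \<le> 2 ^ n * (x $ i + s * d $ i) \<and>
      2 ^ n * (x $ i + s * d $ i) \<le> real_of_int (z i) + 1" for i
  proof -
    have lim: "((\<lambda>s. 2 ^ n * (x $ i + s * d $ i)) \<longlongrightarrow> 2 ^ n * (x $ i + 0 * d $ i)) (at_right 0)"
      by (intro tendsto_intros)
    have pos: "\<forall>\<^sub>F s in at_right 0. s > (0 :: real)"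
      by (rule eventually_at_right_less)
    show ?thesis
    proof (cases "d $ i \<ge> 0")
      case True
      then have "\<forall>\<^sub>F s in at_right 0. 2 ^ n * (x $ i + s * d $ i) < real_of_int (z i) + 1"
        using order_tendstoD(2) [OF lim] z(3) by simp
      with pos show ?thesis
      proof eventually_elim
        case (elim s)
        then have "2 ^ n * x $ i \<le> 2 ^ n * (x $ i + s * d $ i)"
          using True by (intro mult_left_mono) auto
        then show ?case
          using elim z(1) [of i] by linarith
      qed
    next
      case False
      then have "\<forall>\<^sub>F s in at_right 0. real_of_int (z i) < 2 ^ n * (x $ i + s * d $ i)"
        using order_tendstoD(1) [OF lim] z(4) by simp
      with pos show ?thesis
      proof eventually_elim
        case (elim s)
        then have "2 ^ n * (x $ i + s * d $ i) \<le> 2 ^ n * x $ i"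
          using False by (intro mult_left_mono) (auto simp: mult_nonneg_nonpos)
        then show ?case
          using elim z(2) [of i] by linarith
      qed
    qed
  qed
  then show "\<forall>\<^sub>F s in at_right 0. x + s *\<^sub>R d \<in> dyadic_cube n z"
    by (simp add: mem_dyadic_cube eventually_all_finite)
qed

text \<open>The Whitney cubes are locally finite in \<open>U\<close>; what is needed of this is that every interval
  through \<open>x\<close> overlaps one of the cubes that contain \<open>x\<close>.\<close>

lemma whitney_overlap:
  fixes U :: "(real ^ 'm) set"
  assumes U: "open U" "x \<in> U" and C: "C \<in> intervals_in UNIV" "x \<in> C"
  shows "\<exists>m w. (m, w) \<in> whitney U \<and> x \<in> dyadic_cube m w \<and> interior (C \<inter> dyadic_cube m w) \<noteq> {}"
proof -
  obtain n where n: "\<And>z. x \<in> dyadic_cube n z \<Longrightarrow> dyadic_collar n z \<subseteq> U"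
    using small_dyadic_collar [OF U] by blast
  obtain a b where ab: "C = cbox a b" "interior C \<noteq> {}"
    using C(1) by (rule intervals_inE)
  \<comment> \<open>Aim from \<open>x\<close> at an interior point of \<open>C\<close>: past
    \<open>x\<close> the segment runs in \<open>interior C\<close>, and its beginning lies in one
    dyadic cube, hence in the Whitney cube around it.\<close>
  obtain c where c: "c \<in> interior C"
    using ab(2) by blast
  obtain z where z: "x \<in> dyadic_cube n z" "\<forall>\<^sub>F s in at_right 0. x + s *\<^sub>R (c - x) \<in> dyadic_cube n z"
    using dyadic_cube_in_direction by blast
  have "\<forall>\<^sub>F s in at_right 0. s \<le> (1 :: real)"
    unfolding eventually_at_right_field by (intro exI [of _ 1]) auto
  with z(2) eventually_at_right_less [of 0]
  have "\<forall>\<^sub>F s in at_right 0. x + s *\<^sub>R (c - x) \<in> dyadic_cube n z \<and> 0 < s \<and> s \<le> 1"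
    by eventually_elim auto
  then obtain s where s: "x + s *\<^sub>R (c - x) \<in> dyadic_cube n z" "0 < s" "s \<le> 1"
    using eventually_happens' [OF trivial_limit_at_right_real] by blast
  have "x - s *\<^sub>R (x - c) \<in> interior C"
    using c s C(2) ab(1) by (intro mem_interior_convex_shrink) auto
  then have y: "x + s *\<^sub>R (c - x) \<in> interior C"
    by (simp add: algebra_simps)
  obtain m w where mw: "(m, w) \<in> whitney U" "dyadic_cube n z \<subseteq> dyadic_cube m w"
    using whitney_contains [OF n [OF z(1)]] by blast
  have "closure (interior (dyadic_cube m w)) = dyadic_cube m w"
    using closure_interior_interval [OF dyadic_cube_interval [OF subset_UNIV]] .
  \<comment> \<open>The point found may lie on a face of the cube, but an open set that meets the
    closure of the interior also meets the interior.\<close>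
  then have "interior C \<inter> closure (interior (dyadic_cube m w)) \<noteq> {}"
    using y s(1) mw(2) by blast
  then have "interior (C \<inter> dyadic_cube m w) \<noteq> {}"
    by (simp add: open_Int_closure_eq_empty)
  then show ?thesis
    using mw z(1) by blast
qed

section \<open>Countable covers enumerated as divisions\<close>

lemma infinite_compact_cover_of_open:
  fixes U :: "(real ^ 'm) set"
  assumes "open U" "U \<noteq> {}" "U = (\<Union>i\<in>S. K i)" "\<And>i. i \<in> S \<Longrightarrow> compact (K i)"
  shows "infinite S"
proof
  assume "finite S"
  then have "compact U"
    unfolding assms(3) using assms(4) by (rule compact_UN)
  then have "U = UNIV"
    using assms(1,2) compact_imp_closed clopen by metis
  then show False
    using \<open>compact U\<close> compact_imp_bounded not_bounded_UNIV by metis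
qed

text \<open>A division is a sequence over all naturals, so the index set has to be infinite; it is,
  since a finite union of boxes is compact and a nonempty open set is not. The bijection is kept for
  reindexing series.\<close>

lemma division_of_interior:
  fixes G :: "(real ^ 'm) set"
  assumes cover: "interior G = (\<Union>i\<in>S. K i)" and ne: "interior G \<noteq> {}"
    and S: "countable S" and K: "\<And>i. i \<in> S \<Longrightarrow> K i \<in> intervals_in G"
    and no: "\<And>i j. i \<in> S \<Longrightarrow> j \<in> S \<Longrightarrow> i \<noteq> j \<Longrightarrow> nonoverlapping (K i) (K j)"
  shows "\<exists>e. bij_betw e (UNIV :: nat set) S \<and> (\<lambda>k. K (e k)) \<in> divisions G"
proof -
  have "compact (K i)" if "i \<in> S" for i
    using K [OF that] by (auto simp: intervals_in_iff)
  then have "infinite S"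
    using infinite_compact_cover_of_open [OF open_interior ne cover] by blast
  then have e: "bij_betw (from_nat_into S) UNIV S"
    using S by (rule bij_betw_from_nat_into [rotated])
  then have img: "range (from_nat_into S) = S" and inj: "inj (from_nat_into S)"
    by (simp_all add: bij_betw_def)
  have "(\<lambda>k. K (from_nat_into S k)) \<in> divisions G"
    unfolding divisions_def
  proof (intro CollectI conjI allI impI)
    show "K (from_nat_into S k) \<in> intervals_in G" for k
      using K img by blast
    show "nonoverlapping (K (from_nat_into S i)) (K (from_nat_into S j))" if "i \<noteq> j" for i j
      using no img inj that by (metis injD rangeI)
    have "(\<Union>i\<in>S. K i) = (\<Union>i\<in>range (from_nat_into S). K i)"
      by (simp only: img)
    then show "interior G = (\<Union>k. K (from_nat_into S k))"
      using cover by simp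
  qed
  then show ?thesis
    using e by blast
qed

text \<open>The second property lets a common refinement with an arbitrary division reach every
  point of the interior.\<close>

lemma whitney_division:
  fixes G :: "(real ^ 'm) set"
  assumes "interior G \<noteq> {}"
  obtains E where "E \<in> divisions G"
    "\<And>C x. C \<in> intervals_in UNIV \<Longrightarrow> x \<in> C \<Longrightarrow> x \<in> interior G \<Longrightarrow> \<exists>k. x \<in> E k \<and> interior (C \<inter> E k) \<noteq> {}"
proof -
  let ?U = "interior G"
  let ?K = "\<lambda>(n, z :: 'm \<Rightarrow> int). dyadic_cube n z"
  have sub: "?K i \<subseteq> ?U" if "i \<in> whitney ?U" for i
    using that dyadic_cube_subset_collar by (fastforce simp: whitney_def)
  have "\<exists>i\<in>whitney ?U. x \<in> ?K i" if x: "x \<in> ?U" for x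
  proof -
    obtain n where n: "\<And>z. x \<in> dyadic_cube n z \<Longrightarrow> dyadic_collar n z \<subseteq> ?U"
      using small_dyadic_collar [OF open_interior x] by blast
    obtain z where "x \<in> dyadic_cube n z"
      using dyadic_cube_in_direction by blast
    then show ?thesis
      using whitney_contains [OF n] by fastforce
  qed
  then have cover: "?U = (\<Union>i\<in>whitney ?U. ?K i)"
    using sub by blast
  have int: "?K i \<in> intervals_in G" if "i \<in> whitney ?U" for i
    using dyadic_cube_interval [of "fst i" "snd i" G] sub [OF that] interior_subset [of G]
    by (auto simp: case_prod_unfold)
  have no: "nonoverlapping (?K i) (?K j)" if "i \<in> whitney ?U" "j \<in> whitney ?U" "i \<noteq> j" for i j
    using whitney_nonoverlapping [of "fst i" "snd i" ?U "fst j" "snd j"] that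
    by (simp add: case_prod_unfold)
  obtain e :: "nat \<Rightarrow> _" where e: "bij_betw e UNIV (whitney ?U)" "(\<lambda>k. ?K (e k)) \<in> divisions G"
    using division_of_interior [where K = ?K, OF cover assms countableI_type int no] by blast
  show thesis
  proof
    show "(\<lambda>k. ?K (e k)) \<in> divisions G"
      by (rule e(2))
    fix C x assume "C \<in> intervals_in UNIV" "x \<in> C" "x \<in> ?U"
    then obtain m w where mw: "(m, w) \<in> whitney ?U" "x \<in> dyadic_cube m w" "interior (C \<inter> dyadic_cube m w) \<noteq> {}"
      using whitney_overlap [OF open_interior] by blast
    obtain k where "e k = (m, w)"
      using e(1) mw(1) by (metis bij_betw_imp_surj_on imageE)
    then have "x \<in> ?K (e k) \<and> interior (C \<inter> ?K (e k)) \<noteq> {}"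
      using mw by simp
    then show "\<exists>k. x \<in> ?K (e k) \<and> interior (C \<inter> ?K (e k)) \<noteq> {}" ..
  qed
qed

section \<open>Hake-functions\<close>

lemma nonneg_bounded_vanishing_tails:
  fixes m :: "'i \<Rightarrow> real"
  assumes bnd: "\<And>T. finite T \<Longrightarrow> sum m T \<le> B" and "\<eta> > 0"
  shows "\<exists>S. finite S \<and> (\<forall>T. finite T \<and> T \<inter> S = {} \<longrightarrow> sum m T < \<eta>)"
proof -
  let ?X = "sum m ` Collect finite"
  have bdd: "bdd_above ?X"
    using bnd by (auto intro!: bdd_aboveI2)
  have "Sup ?X - \<eta> < Sup ?X"
    using \<open>\<eta> > 0\<close> by simp
  then obtain S where S: "finite S" "Sup ?X - \<eta> < sum m S"
    using less_cSupD [of ?X "Sup ?X - \<eta>"] by auto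
  have "sum m T < \<eta>" if "finite T" "T \<inter> S = {}" for T
  proof -
    have "sum m (T \<union> S) = sum m T + sum m S"
      using that S(1) by (intro sum.union_disjoint)
    moreover have "sum m (T \<union> S) \<le> Sup ?X"
      using that(1) S(1) bdd by (intro cSup_upper) auto
    ultimately show ?thesis
      using S(2) by linarith
  qed
  then show ?thesis
    using S(1) by blast
qed

lemma divisionsD:
  assumes "C \<in> divisions G"
  shows "C k \<in> intervals_in G" "i \<noteq> j \<Longrightarrow> nonoverlapping (C i) (C j)" "interior G = (\<Union>k. C k)"
  using assms by (auto simp: divisions_def)

lemma overlap_term_division:
  assumes "I \<in> intervals_in E" "C \<in> divisions G"
  shows "overlap_term F C I k = (if interior (I \<inter> C k) \<noteq> {} then F (I \<inter> C k) else 0)"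
  using measure_Int_pos_iff [OF assms(1) divisionsD(1) [OF assms(2)]]
  by (simp add: overlap_term_def del: interior_Int)

text \<open>The pieces \<open>I \<inter> C k\<close> do not overlap, so the partial sums of their
  measures are bounded by the measure of \<open>I\<close> and have vanishing tails. Absolute
  continuity of the primitive on \<open>I\<close> turns small measure into small norm of the sums of
  \<open>H\<close>.\<close>

lemma overlap_term_summable:
  fixes h :: "real ^ 'm \<Rightarrow> 'x::banach"
  assumes H: "additive_interval_function UNIV H"
    and int: "\<And>K. K \<in> intervals_in UNIV \<Longrightarrow> has_McShane_integral h (H K) K"
    and HF: "\<And>K. K \<in> intervals_in G \<Longrightarrow> H K = F K"
    and C: "C \<in> divisions G" and I: "I \<in> intervals_in UNIV"
  shows "overlap_term F C I summable_on UNIV"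
proof (rule summable_on_vanishing_tails)
  fix \<epsilon> :: real assume "\<epsilon> > 0"
  have int': "has_McShane_integral h (H K) K" if "K \<in> intervals_in I" for K
    using int intervals_in_imp_UNIV that by blast
  define B where "B = {k. interior (I \<inter> C k) \<noteq> {}}"
  have IC: "I \<inter> C k \<in> intervals_in I" "I \<inter> C k \<in> intervals_in G" if "k \<in> B" for k
  proof -
    show "I \<inter> C k \<in> intervals_in G"
      using Int_intervals_in [OF I divisionsD(1) [OF C]] that by (simp add: B_def)
    then show "I \<inter> C k \<in> intervals_in I"
      by (simp add: intervals_in_iff)
  qed
  have term_eq: "overlap_term F C I k = (if k \<in> B then H (I \<inter> C k) else 0)" for k
    using overlap_term_division [OF I C, of F k] HF IC by (simp add: B_def)
  have no: "nonoverlapping (I \<inter> C i) (I \<inter> C j)" if "i \<noteq> j" for i j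
    using divisionsD(2) [OF C that] by (rule nonoverlapping_mono) auto
  obtain \<eta> where \<eta>: "\<eta> > 0" "\<And>A (K :: nat \<Rightarrow> _). finite A \<Longrightarrow> (\<And>x. x \<in> A \<Longrightarrow> K x \<in> intervals_in I) \<Longrightarrow>
      (\<And>x y. x \<in> A \<Longrightarrow> y \<in> A \<Longrightarrow> x \<noteq> y \<Longrightarrow> nonoverlapping (K x) (K y)) \<Longrightarrow>
      (\<Sum>x\<in>A. measure lebesgue (K x)) < \<eta> \<Longrightarrow> norm (\<Sum>x\<in>A. H (K x)) < \<epsilon>"
    using interval_function_absolutely_continuous [OF H I int' \<open>\<epsilon> > 0\<close>, where 'i = nat] by blast
  define m where "m k = (if k \<in> B then measure lebesgue (I \<inter> C k) else 0)" for k
  have m: "sum m T = (\<Sum>k\<in>T \<inter> B. measure lebesgue (I \<inter> C k))" if "finite T" for T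
    using that by (simp add: m_def sum.inter_restrict)
  have bnd: "sum m T \<le> measure lebesgue I" if "finite T" for T
    unfolding m [OF that]
    using that IC(1) no interval_lmeasurable [OF I] by (intro sum_measure_nonoverlapping_le) auto
  from nonneg_bounded_vanishing_tails [where m = m, OF bnd \<eta>(1)]
  obtain S where S: "finite S" "\<And>T. finite T \<Longrightarrow> T \<inter> S = {} \<Longrightarrow> sum m T < \<eta>"
    by blast
  have "norm (sum (overlap_term F C I) T) < \<epsilon>" if T: "finite T" "T \<inter> S = {}" for T
  proof -
    have "sum (overlap_term F C I) T = (\<Sum>k\<in>T \<inter> B. H (I \<inter> C k))"
      using T by (simp add: term_eq sum.inter_restrict)
    moreover have "norm (\<Sum>k\<in>T \<inter> B. H (I \<inter> C k)) < \<epsilon>"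
      using T IC(1) no S(2) [OF T] by (intro \<eta>(2)) (auto simp: m)
    ultimately show ?thesis
      by simp
  qed
  then show "\<exists>S. finite S \<and> S \<subseteq> UNIV \<and> (\<forall>T. finite T \<and> T \<subseteq> UNIV \<and> T \<inter> S = {} \<longrightarrow>
      norm (sum (overlap_term F C I) T) < \<epsilon>)"
    using S(1) by blast
qed

lemma summable_on_sums_infsum:
  fixes a :: "nat \<Rightarrow> 'x::banach"
  assumes "a summable_on UNIV" shows "a sums infsum a UNIV"
  using assms by (intro has_sum_imp_sums has_sum_infsum)

section \<open>Sums along two divisions\<close>

lemma Hake_functionD:
  assumes "Hake_function G F" "C \<in> divisions G"
  shows "I \<in> intervals_in UNIV \<Longrightarrow> overlap_term F C I summable_on UNIV"
    "I \<in> intervals_in G \<Longrightarrow> overlap_term F C I sums F I"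
  using assms unfolding Hake_function_def by blast+

lemma Hake_function_infsum:
  fixes F :: "(real ^ 'm) set \<Rightarrow> 'x::banach"
  assumes F: "Hake_function G F" and C: "C \<in> divisions G" and I: "I \<in> intervals_in G"
  shows "infsum (overlap_term F C I) UNIV = F I"
proof -
  have "overlap_term F C I sums infsum (overlap_term F C I) UNIV"
    using summable_on_sums_infsum Hake_functionD(1) [OF F C intervals_in_imp_UNIV [OF I]] .
  then show ?thesis
    using sums_unique2 Hake_functionD(2) [OF F C I] by blast
qed

text \<open>This is the Hake property along \<open>E\<close>, applied to the interval
  \<open>I \<inter> C k\<close>; if that intersection is flat, all terms vanish.\<close>

lemma infsum_overlap_term_Int:
  fixes F :: "(real ^ 'm) set \<Rightarrow> 'x::banach"
  assumes F: "Hake_function G F" and C: "C \<in> divisions G" and E: "E \<in> divisions G"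
    and I: "I \<in> intervals_in UNIV"
  shows "infsum (\<lambda>j. if interior (I \<inter> (C k \<inter> E j)) \<noteq> {} then F (I \<inter> (C k \<inter> E j)) else 0) UNIV =
    overlap_term F C I k"
proof (cases "interior (I \<inter> C k) = {}")
  case True
  then have "interior (I \<inter> (C k \<inter> E j)) = {}" for j
    using interior_mono [of "I \<inter> (C k \<inter> E j)" "I \<inter> C k"] by blast
  then show ?thesis
    using True by (simp add: overlap_term_division [OF I C] del: interior_Int)
next
  case False
  then have IC: "I \<inter> C k \<in> intervals_in G"
    using Int_intervals_in [OF I divisionsD(1) [OF C]] by blast
  have "(\<lambda>j. if interior (I \<inter> (C k \<inter> E j)) \<noteq> {} then F (I \<inter> (C k \<inter> E j)) else 0) =
      overlap_term F E (I \<inter> C k)"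
    by (rule ext) (simp only: overlap_term_division [OF IC E] Int_assoc)
  then show ?thesis
    using Hake_function_infsum [OF F E IC] False
    by (simp add: overlap_term_division [OF I C] del: interior_Int)
qed

text \<open>Two divisions of \<open>interior G\<close> need not have a common refinement: the nondegenerate
  intersections of their members can miss points.  They do cover \<open>interior G\<close> when \<open>E\<close> satisfies
  the last hypothesis, and then unconditional convergence along the refinement justifies
  interchanging the two summations.\<close>

lemma overlap_infsum_eq:
  fixes F :: "(real ^ 'm) set \<Rightarrow> 'x::banach"
  assumes F: "Hake_function G F" and C: "C \<in> divisions G" and E: "E \<in> divisions G"
    and I: "I \<in> intervals_in UNIV" and ne: "interior G \<noteq> {}"
    and refine: "\<And>K x. K \<in> intervals_in UNIV \<Longrightarrow> x \<in> K \<Longrightarrow> x \<in> interior G \<Longrightarrow>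
      \<exists>j. x \<in> E j \<and> interior (K \<inter> E j) \<noteq> {}"
  shows "infsum (overlap_term F C I) UNIV = infsum (overlap_term F E I) UNIV"
proof -
  define P where "P = {(k, j). interior (C k \<inter> E j) \<noteq> {}}"
  define K where "K = (\<lambda>(k, j). C k \<inter> E j)"
  define g where "g k j = (if interior (I \<inter> (C k \<inter> E j)) \<noteq> {} then F (I \<inter> (C k \<inter> E j)) else 0)" for k j
  have K_int: "K i \<in> intervals_in G" if "i \<in> P" for i
    using Int_intervals_in [OF intervals_in_imp_UNIV [OF divisionsD(1) [OF C]] divisionsD(1) [OF E]] that
    by (auto simp: P_def K_def simp del: interior_Int)
  have K_no: "nonoverlapping (K i) (K j)" if "i \<noteq> j" for i j
  proof (cases "fst i = fst j")
    case True
    then have "snd i \<noteq> snd j"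
      using that by (simp add: prod_eq_iff)
    then have "nonoverlapping (E (snd i)) (E (snd j))"
      by (rule divisionsD(2) [OF E])
    then show ?thesis
      by (rule nonoverlapping_mono) (auto simp: K_def case_prod_unfold)
  next
    case False
    then have "nonoverlapping (C (fst i)) (C (fst j))"
      by (rule divisionsD(2) [OF C])
    then show ?thesis
      by (rule nonoverlapping_mono) (auto simp: K_def case_prod_unfold)
  qed
  have cover: "interior G = (\<Union>i\<in>P. K i)"
  proof (intro equalityI subsetI)
    fix x assume x: "x \<in> interior G"
    then obtain k where k: "x \<in> C k"
      using divisionsD(3) [OF C] by blast
    \<comment> \<open>With \<open>C k\<close> as the interval, \<open>refine\<close> rules out that
      \<open>x\<close> lies only in flat intersections.\<close>
    obtain j where "x \<in> E j" "interior (C k \<inter> E j) \<noteq> {}"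
      using refine [OF intervals_in_imp_UNIV [OF divisionsD(1) [OF C]] k x] by blast
    then have "(k, j) \<in> P" "x \<in> K (k, j)"
      using k by (simp_all add: P_def K_def)
    then show "x \<in> (\<Union>i\<in>P. K i)" by blast
  next
    fix x assume "x \<in> (\<Union>i\<in>P. K i)"
    then show "x \<in> interior G"
      using divisionsD(3) [OF C] by (auto simp: K_def)
  qed
  obtain e where e: "bij_betw e (UNIV :: nat set) P" "(\<lambda>n. K (e n)) \<in> divisions G"
    using division_of_interior [where K = K, OF cover ne countableI_type K_int K_no] by blast
  have "overlap_term F (\<lambda>n. K (e n)) I n = case_prod g (e n)" for n
    using overlap_term_division [OF I e(2), of F n]
    by (simp add: g_def K_def case_prod_unfold del: interior_Int)
  then have "overlap_term F (\<lambda>n. K (e n)) I = (\<lambda>n. case_prod g (e n))"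
    by (rule ext)
  \<comment> \<open>The refinement is itself a division, so the Hake property includes unconditional
    convergence along it.\<close>
  then have "(\<lambda>n. case_prod g (e n)) summable_on UNIV"
    using Hake_functionD(1) [OF F e(2) I] by simp
  then have "case_prod g summable_on P"
    using summable_on_reindex_bij_betw [OF e(1), of "case_prod g"] by simp
  moreover have "case_prod g i = 0" if "i \<notin> P" for i
  proof -
    have "interior (C (fst i) \<inter> E (snd i)) = {}"
      using that by (simp add: P_def case_prod_unfold)
    then have "interior (I \<inter> (C (fst i) \<inter> E (snd i))) = {}"
      using interior_mono [of "I \<inter> (C (fst i) \<inter> E (snd i))" "C (fst i) \<inter> E (snd i)"] by blast
    then show ?thesis
      by (simp add: g_def case_prod_unfold del: interior_Int)
  qed
  \<comment> \<open>Pairs outside \<open>P\<close> contribute 0, and summability on the full product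
    is what allows the iterated sums to be exchanged.\<close>
  ultimately have "case_prod g summable_on UNIV \<times> UNIV"
    by (subst summable_on_cong_neutral [where g = "case_prod g" and T = P]) auto
  then have "infsum (\<lambda>k. infsum (\<lambda>j. g k j) UNIV) UNIV = infsum (\<lambda>j. infsum (\<lambda>k. g k j) UNIV) UNIV"
    by (rule infsum_swap_banach)
  moreover have "infsum (\<lambda>j. g k j) UNIV = overlap_term F C I k" for k
    unfolding g_def by (rule infsum_overlap_term_Int [OF F C E I])
  moreover have "infsum (\<lambda>k. g k j) UNIV = overlap_term F E I j" for j
    using infsum_overlap_term_Int [OF F E C I, of j] unfolding g_def Int_commute [of "C _" "E _"] .
  ultimately show ?thesis
    by simp
qed

text \<open>Each member of \<open>E\<close> cuts \<open>I\<close>, \<open>J\<close> and their union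
  in boxes that may be flat, so the zero extension gives additivity term by term.\<close>

lemma infsum_overlap_term_additive:
  fixes F :: "(real ^ 'm) set \<Rightarrow> 'x::banach"
  assumes F: "Hake_function G F" and E: "E \<in> divisions G"
  shows "additive_interval_function UNIV (\<lambda>I. infsum (overlap_term F E I) UNIV)"
  unfolding additive_interval_function_def
proof (intro ballI impI, elim conjE)
  fix I J :: "(real ^ 'm) set"
  assume I: "I \<in> intervals_in UNIV" and J: "J \<in> intervals_in UNIV"
    and no: "nonoverlapping I J" and IJ: "I \<union> J \<in> intervals_in UNIV"
  have F': "additive_interval_function G F"
    using F by (simp add: Hake_function_def)
  have "overlap_term F E (I \<union> J) k = overlap_term F E I k + overlap_term F E J k" for k
  proof -
    have Ek: "E k \<in> intervals_in G"
      by (rule divisionsD(1) [OF E])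
    have box: "\<exists>a b. K \<inter> E k = cbox a b" if "K \<in> intervals_in UNIV" for K
      using that Ek cbox_Int_cbox unfolding intervals_in_iff by metis
    have un: "(I \<inter> E k) \<union> (J \<inter> E k) = (I \<union> J) \<inter> E k"
      by blast
    have "nonoverlapping (I \<inter> E k) (J \<inter> E k)"
      using no by (rule nonoverlapping_mono) auto
    moreover have "(I \<inter> E k) \<union> (J \<inter> E k) \<subseteq> G"
      using intervals_in_subset [OF Ek] by blast
    moreover have "\<exists>a b. (I \<inter> E k) \<union> (J \<inter> E k) = cbox a b"
      unfolding un by (rule box [OF IJ])
    ultimately show ?thesis
      using additive_zero_extension [OF F' box [OF I] box [OF J]]
      unfolding overlap_term_division [OF I E] overlap_term_division [OF J E] overlap_term_division [OF IJ E] un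
      by blast
  qed
  then have "overlap_term F E (I \<union> J) = (\<lambda>k. overlap_term F E I k + overlap_term F E J k)"
    by (rule ext)
  then show "infsum (overlap_term F E (I \<union> J)) UNIV =
      infsum (overlap_term F E I) UNIV + infsum (overlap_term F E J) UNIV"
    using infsum_add [OF Hake_functionD(1) [OF F E I] Hake_functionD(1) [OF F E J]] by simp
qed

lemma additive_interval_function_partition:
  fixes H :: "(real ^ 'm) set \<Rightarrow> 'x::real_normed_vector"
  assumes H: "additive_interval_function UNIV H" and I: "I \<in> intervals_in UNIV"
    and \<pi>: "M_partition_of I \<pi>"
  shows "H I = (\<Sum>(t, K)\<in>\<pi>. H K)"
proof -
  have \<pi>': "M_partition_in I \<pi>" "\<Union>(snd ` \<pi>) = I"
    using \<pi> by (auto simp: M_partition_of_def case_prod_unfold)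
  have "H I = (\<Sum>K\<in>snd ` \<pi>. H K)"
  proof (rule additive_interval_function_division [OF H I])
    show "snd ` \<pi> division_of I"
      using M_partition_in_division [OF \<pi>'(1)] \<pi>'(2) by simp
    show "interior K \<noteq> {}" if "K \<in> snd ` \<pi>" for K
      using \<pi>'(1) that by (auto simp: M_partition_in_def intervals_in_iff)
  qed
  then show ?thesis
    using M_partition_in_inj_on_snd [OF \<pi>'(1)] by (simp add: sum.reindex case_prod_unfold)
qed

section \<open>The Hake-McShane integral\<close>

lemma M_partition_in_UNIV:
  "M_partition_in E \<pi> \<Longrightarrow> M_partition_in UNIV \<pi>"
  by (rule M_partition_in_restrict) auto

text \<open>Tags outside \<open>G\<close> contribute nothing, since \<open>h\<close> vanishes there;
  the remaining ones lie in the null set.\<close>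

lemma null_tags_outside_interior:
  fixes h :: "real ^ 'm \<Rightarrow> 'x::real_normed_vector"
  assumes N: "G - interior G \<in> null_sets lebesgue" and h: "\<forall>t. t \<notin> G \<longrightarrow> h t = 0" and "\<epsilon> > 0"
  shows "\<exists>\<delta>. gauge_on (UNIV - interior G) \<delta> \<and>
    (\<forall>\<pi>. M_partition_in UNIV \<pi> \<and> tagged_in (UNIV - interior G) \<pi> \<and> gauge_fine \<delta> \<pi> \<longrightarrow>
      norm (\<Sum>(t, I)\<in>\<pi>. measure lebesgue I *\<^sub>R h t) < \<epsilon>)"
proof -
  let ?N = "G - interior G"
  obtain d where d: "gauge_on ?N d" and
    dsum: "\<forall>\<pi>. M_partition_in UNIV \<pi> \<and> tagged_in ?N \<pi> \<and> gauge_fine d \<pi> \<longrightarrow>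
      norm (\<Sum>(t, I)\<in>\<pi>. measure lebesgue I *\<^sub>R h t) < \<epsilon>"
    using null_tags [OF N \<open>\<epsilon> > 0\<close>, of h] by (elim exE conjE)
  define \<delta> where "\<delta> t = (if t \<in> G then d t else 1)" for t
  have "gauge_on (UNIV - interior G) \<delta>"
    using d by (auto simp: gauge_on_def \<delta>_def)
  moreover have "norm (\<Sum>(t, I)\<in>\<pi>. measure lebesgue I *\<^sub>R h t) < \<epsilon>"
    if \<pi>: "M_partition_in UNIV \<pi>" "tagged_in (UNIV - interior G) \<pi>" "gauge_fine \<delta> \<pi>" for \<pi>
  proof -
    define \<pi>' where "\<pi>' = {p \<in> \<pi>. fst p \<in> G}"
    have fin: "finite \<pi>"
      using \<pi>(1) by (simp add: M_partition_in_def)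
    have "(\<Sum>(t, I)\<in>\<pi>. measure lebesgue I *\<^sub>R h t) = (\<Sum>(t, I)\<in>\<pi>'. measure lebesgue I *\<^sub>R h t)"
    proof (rule sum.mono_neutral_right [OF fin])
      show "\<forall>p\<in>\<pi> - \<pi>'. (case p of (t, I) \<Rightarrow> measure lebesgue I *\<^sub>R h t) = 0"
        using h by (simp add: \<pi>'_def case_prod_unfold)
    qed (auto simp: \<pi>'_def)
    moreover have "M_partition_in UNIV \<pi>'"
      using \<pi>(1) by (rule M_partition_in_subset) (auto simp: \<pi>'_def)
    moreover have "tagged_in ?N \<pi>'"
      using \<pi>(2) by (auto simp: tagged_in_def \<pi>'_def)
    moreover have "gauge_fine d \<pi>'"
      by (rule gauge_fine_mono [OF gauge_fine_subset [OF \<pi>(3)]]) (auto simp: \<pi>'_def \<delta>_def)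
    ultimately show ?thesis
      using dsum by simp
  qed
  ultimately show ?thesis
    by blast
qed

text \<open>The thirds of \<open>\<epsilon>\<close> go to condition (a) for interior tags and, for
  the other tags, to the sum of \<open>H\<close> through negligible variation and to the sum of
  \<open>h\<close> through the null set. Any division \<open>E\<close> may define \<open>H\<close>
  here.\<close>

lemma Hake_McShane_imp_has_McShane_integral:
  fixes f h :: "real ^ 'm \<Rightarrow> 'x::banach"
  assumes N: "G - interior G \<in> null_sets lebesgue"
    and h: "\<And>t. h t = (if t \<in> G then f t else 0)"
    and f: "Hake_McShane_integrable_with_primitive f F G"
    and E: "E \<in> divisions G" and J: "J \<in> intervals_in UNIV"
  shows "has_McShane_integral h (infsum (overlap_term F E J) UNIV) J"
  unfolding has_McShane_integral_def
proof (intro allI impI)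
  fix \<epsilon> :: real assume "\<epsilon> > 0"
  then have e: "\<epsilon> / 3 > 0"
    by simp
  define H where "H I = infsum (overlap_term F E I) UNIV" for I
  have Hake: "Hake_function G F"
    using f by (simp add: Hake_McShane_integrable_with_primitive_def)
  have H: "additive_interval_function UNIV H"
    unfolding H_def using infsum_overlap_term_additive [OF Hake E] .
  have HF: "H I = F I" if "I \<in> intervals_in G" for I
    unfolding H_def by (rule Hake_function_infsum [OF Hake E that])
  \<comment> \<open>The negligible variation speaks of the ordered sum, whereas \<open>H\<close> is
    defined by the unordered one.\<close>
  have Hsum: "(\<Sum>k. overlap_term F E I k) = H I" if "I \<in> intervals_in UNIV" for I
    using sums_unique [OF summable_on_sums_infsum [OF Hake_functionD(1) [OF Hake E that]]]
    by (simp add: H_def)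
  obtain da where da: "gauge_on (interior G) da" and
    da_sum: "\<forall>\<pi>. M_partition_in (interior G) \<pi> \<and> gauge_fine da \<pi> \<longrightarrow>
      norm (\<Sum>(t, I)\<in>\<pi>. measure lebesgue I *\<^sub>R f t - F I) < \<epsilon> / 3"
    using f e unfolding Hake_McShane_integrable_with_primitive_def by blast
  obtain dv where dv: "gauge_on (UNIV - interior G) dv" and
    dv_sum: "\<forall>\<pi>. M_partition_in UNIV \<pi> \<and> tagged_in (UNIV - interior G) \<pi> \<and> gauge_fine dv \<pi> \<longrightarrow>
      (\<forall>C\<in>divisions G. (\<forall>(t, I)\<in>\<pi>. overlap_term F C I summable_on UNIV) \<and>
        norm (\<Sum>(t, I)\<in>\<pi>. \<Sum>k. overlap_term F C I k) < \<epsilon> / 3)"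
    using f e unfolding Hake_McShane_integrable_with_primitive_def
      M_negligible_variation_outside_interior_def M_negligible_variation_over_def by blast
  have h0: "\<forall>t. t \<notin> G \<longrightarrow> h t = 0"
    using h by simp
  obtain dn where dn: "gauge_on (UNIV - interior G) dn" and
    dn_sum: "\<forall>\<pi>. M_partition_in UNIV \<pi> \<and> tagged_in (UNIV - interior G) \<pi> \<and> gauge_fine dn \<pi> \<longrightarrow>
      norm (\<Sum>(t, I)\<in>\<pi>. measure lebesgue I *\<^sub>R h t) < \<epsilon> / 3"
    using null_tags_outside_interior [where h = h, OF N h0 e] by (elim exE conjE)
  \<comment> \<open>A tag in the interior does not by itself force its interval into the interior.
    The radius \<open>r t\<close> does, so the interval belongs to \<open>intervals_in G\<close> and
    \<open>H\<close> agrees with \<open>F\<close> on it.\<close>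
  have "\<forall>t. \<exists>r. t \<in> interior G \<longrightarrow> r > 0 \<and> max_ball t r \<subseteq> interior G"
    using open_contains_max_ball [OF open_interior] by metis
  then obtain r where r: "\<And>t. t \<in> interior G \<Longrightarrow> r t > 0" "\<And>t. t \<in> interior G \<Longrightarrow> max_ball t (r t) \<subseteq> interior G"
    by metis
  define \<delta> where "\<delta> t = (if t \<in> interior G then min (da t) (r t) else min (dv t) (dn t))" for t
  have "gauge_on J \<delta>"
    using da dv dn r(1) by (auto simp: gauge_on_def \<delta>_def)
  moreover have "norm ((\<Sum>(t, I)\<in>\<pi>. measure lebesgue I *\<^sub>R h t) - H J) < \<epsilon>"
    if \<pi>: "M_partition_of J \<pi>" "gauge_fine \<delta> \<pi>" for \<pi>
  proof -
    have \<pi>_in: "M_partition_in UNIV \<pi>"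
      using \<pi>(1) M_partition_in_UNIV by (auto simp: M_partition_of_def)
    then have fin: "finite \<pi>" and \<pi>_int: "\<And>t I. (t, I) \<in> \<pi> \<Longrightarrow> I \<in> intervals_in UNIV"
      by (auto simp: M_partition_in_def)
    define \<rho> where "\<rho> = {p \<in> \<pi>. fst p \<in> interior G}"
    define \<sigma> where "\<sigma> = {p \<in> \<pi>. fst p \<notin> interior G}"
    have split: "sum g \<pi> = sum g \<rho> + sum g \<sigma>" for g :: "_ \<Rightarrow> 'x"
    proof -
      have "sum g (\<rho> \<union> \<sigma>) = sum g \<rho> + sum g \<sigma>"
        using fin by (intro sum.union_disjoint) (auto simp: \<rho>_def \<sigma>_def)
      moreover have "\<rho> \<union> \<sigma> = \<pi>"
        by (auto simp: \<rho>_def \<sigma>_def)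
      ultimately show ?thesis
        by simp
    qed
    have sub: "\<rho> \<subseteq> \<pi>" "\<sigma> \<subseteq> \<pi>"
      by (auto simp: \<rho>_def \<sigma>_def)
    have \<rho>_sub: "I \<subseteq> interior G" if "(t, I) \<in> \<rho>" for t I
    proof -
      have t: "t \<in> interior G" "(t, I) \<in> \<pi>"
        using that by (auto simp: \<rho>_def)
      have "I \<subseteq> max_ball t (\<delta> t)"
        using gauge_fineD [OF \<pi>(2) t(2)] .
      also have "\<dots> \<subseteq> max_ball t (r t)"
        using t(1) by (intro max_ball_mono) (simp add: \<delta>_def)
      also have "\<dots> \<subseteq> interior G"
        using r(2) t(1) .
      finally show ?thesis .
    qed
    have "M_partition_in (interior G) \<rho>"
    proof (rule M_partition_in_restrict [OF M_partition_in_subset [OF \<pi>_in sub(1)]])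
      show "t \<in> interior G" if "(t, I) \<in> \<rho>" for t I
        using that by (simp add: \<rho>_def)
    qed (rule \<rho>_sub)
    moreover have "gauge_fine da \<rho>"
      by (rule gauge_fine_mono [OF gauge_fine_subset [OF \<pi>(2) sub(1)]]) (auto simp: \<rho>_def \<delta>_def)
    ultimately have "norm (\<Sum>(t, I)\<in>\<rho>. measure lebesgue I *\<^sub>R f t - F I) < \<epsilon> / 3"
      using da_sum by blast
    moreover have "(\<Sum>(t, I)\<in>\<rho>. measure lebesgue I *\<^sub>R f t - F I) =
        (\<Sum>(t, I)\<in>\<rho>. measure lebesgue I *\<^sub>R h t - H I)"
    proof (rule sum.cong [OF refl], clarify)
      fix t I assume tI: "(t, I) \<in> \<rho>"
      then have "t \<in> G"
        using interior_subset by (auto simp: \<rho>_def)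
      moreover have "I \<in> intervals_in G"
        using \<pi>_int [of t I] \<rho>_sub [OF tI] sub(1) tI interior_subset [of G]
        by (auto simp: intervals_in_iff)
      ultimately show "measure lebesgue I *\<^sub>R f t - F I = measure lebesgue I *\<^sub>R h t - H I"
        by (simp add: h HF)
    qed
    ultimately have 1: "norm (\<Sum>(t, I)\<in>\<rho>. measure lebesgue I *\<^sub>R h t - H I) < \<epsilon> / 3"
      by simp
    have \<sigma>: "M_partition_in UNIV \<sigma>" "tagged_in (UNIV - interior G) \<sigma>"
      "gauge_fine dv \<sigma>" "gauge_fine dn \<sigma>"
    proof -
      show "M_partition_in UNIV \<sigma>"
        by (rule M_partition_in_subset [OF \<pi>_in sub(2)])
      show "tagged_in (UNIV - interior G) \<sigma>"
        by (auto simp: tagged_in_def \<sigma>_def)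
      show "gauge_fine dv \<sigma>" "gauge_fine dn \<sigma>"
        by (rule gauge_fine_mono [OF gauge_fine_subset [OF \<pi>(2) sub(2)]]; auto simp: \<sigma>_def \<delta>_def)+
    qed
    then have "norm (\<Sum>(t, I)\<in>\<sigma>. \<Sum>k. overlap_term F E I k) < \<epsilon> / 3"
      using dv_sum E by blast
    moreover have "(\<Sum>(t, I)\<in>\<sigma>. \<Sum>k. overlap_term F E I k) = (\<Sum>(t, I)\<in>\<sigma>. H I)"
      using Hsum \<pi>_int sub(2) by (intro sum.cong) auto
    ultimately have 2: "norm (\<Sum>(t, I)\<in>\<sigma>. H I) < \<epsilon> / 3"
      by simp
    have 3: "norm (\<Sum>(t, I)\<in>\<sigma>. measure lebesgue I *\<^sub>R h t) < \<epsilon> / 3"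
      using dn_sum \<sigma> by blast
    have "(\<Sum>(t, I)\<in>\<pi>. measure lebesgue I *\<^sub>R h t) - H J =
        (\<Sum>(t, I)\<in>\<pi>. measure lebesgue I *\<^sub>R h t - H I)"
      unfolding additive_interval_function_partition [OF H J \<pi>(1)]
      by (simp add: case_prod_unfold sum_subtractf)
    also have "\<dots> = (\<Sum>(t, I)\<in>\<rho>. measure lebesgue I *\<^sub>R h t - H I) +
        ((\<Sum>(t, I)\<in>\<sigma>. measure lebesgue I *\<^sub>R h t) - (\<Sum>(t, I)\<in>\<sigma>. H I))"
      unfolding split by (simp add: case_prod_unfold sum_subtractf)
    finally have eq: "(\<Sum>(t, I)\<in>\<pi>. measure lebesgue I *\<^sub>R h t) - H J = \<dots>" .
    show ?thesis
      unfolding eq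
      using 1 2 3 norm_triangle_ineq4 [of "\<Sum>(t, I)\<in>\<sigma>. measure lebesgue I *\<^sub>R h t" "\<Sum>(t, I)\<in>\<sigma>. H I"]
      by (intro le_less_trans [OF norm_triangle_ineq]) linarith
  qed
  ultimately show "\<exists>\<delta>. gauge_on J \<delta> \<and> (\<forall>\<pi>. M_partition_of J \<pi> \<and> gauge_fine \<delta> \<pi> \<longrightarrow>
      norm ((\<Sum>(t, I)\<in>\<pi>. measure lebesgue I *\<^sub>R h t) - infsum (overlap_term F E J) UNIV) < \<epsilon>)"
    unfolding H_def by blast
qed

text \<open>A single gauge has to serve every division in the negligible variation. It is chosen
  from \<open>h\<close> and \<open>H\<close> alone, because the series sums to \<open>H I\<close>
  along each division.\<close>

lemma Hake_McShane_integrable_if_locally_McShane: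
  fixes f h :: "real ^ 'm \<Rightarrow> 'x::banach"
  assumes N: "G - interior G \<in> null_sets lebesgue" and F: "additive_interval_function G F"
    and h: "\<And>t. h t = (if t \<in> G then f t else 0)"
    and H: "additive_interval_function UNIV H"
    and int: "\<forall>K\<in>intervals_in UNIV. has_McShane_integral h (H K) K"
    and HF: "\<And>I. I \<in> intervals_in G \<Longrightarrow> H I = F I"
    and sums: "\<And>C I. C \<in> divisions G \<Longrightarrow> I \<in> intervals_in UNIV \<Longrightarrow> overlap_term F C I sums H I"
  shows "Hake_McShane_integrable_with_primitive f F G"
proof -
  have summable: "overlap_term F C I summable_on UNIV"
    if "C \<in> divisions G" "I \<in> intervals_in UNIV" for C I
    using overlap_term_summable [OF H bspec [OF int] HF that] .
  have 1: "\<exists>\<delta>. gauge_on (interior G) \<delta> \<and>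
      (\<forall>\<pi>. M_partition_in (interior G) \<pi> \<and> gauge_fine \<delta> \<pi> \<longrightarrow>
        norm (\<Sum>(t, I)\<in>\<pi>. measure lebesgue I *\<^sub>R f t - F I) < \<epsilon>)" if \<epsilon>: "\<epsilon> > 0" for \<epsilon> :: real
  proof -
    obtain \<delta> where \<delta>: "gauge_on UNIV \<delta>" and
      SH: "\<forall>\<pi>. M_partition_in UNIV \<pi> \<and> gauge_fine \<delta> \<pi> \<longrightarrow>
        norm (\<Sum>(t, I)\<in>\<pi>. measure lebesgue I *\<^sub>R h t - H I) < \<epsilon>"
      using global_Saks_Henstock [OF H int \<epsilon>] by (elim exE conjE)
    have "norm (\<Sum>(t, I)\<in>\<pi>. measure lebesgue I *\<^sub>R f t - F I) < \<epsilon>"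
      if \<pi>: "M_partition_in (interior G) \<pi>" "gauge_fine \<delta> \<pi>" for \<pi>
    proof -
      have "(\<Sum>(t, I)\<in>\<pi>. measure lebesgue I *\<^sub>R f t - F I) =
          (\<Sum>(t, I)\<in>\<pi>. measure lebesgue I *\<^sub>R h t - H I)"
      proof (rule sum.cong [OF refl], clarify)
        fix t I assume "(t, I) \<in> \<pi>"
        then have "t \<in> interior G" "I \<in> intervals_in (interior G)"
          using \<pi>(1) by (auto simp: M_partition_in_def)
        then have "t \<in> G" "I \<in> intervals_in G"
          using interior_subset [of G] by (auto simp: intervals_in_iff)
        then show "measure lebesgue I *\<^sub>R f t - F I = measure lebesgue I *\<^sub>R h t - H I"
          by (simp add: h HF)
      qed
      then show ?thesis
        using SH M_partition_in_UNIV [OF \<pi>(1)] \<pi>(2) by simp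
    qed
    moreover have "gauge_on (interior G) \<delta>"
      using \<delta> by (simp add: gauge_on_def)
    ultimately show ?thesis
      by blast
  qed
  have 2: "Hake_function G F"
    unfolding Hake_function_def
  proof (intro conjI ballI)
    show "overlap_term F C I sums F I" if "C \<in> divisions G" "I \<in> intervals_in G" for C I
      using sums [OF that(1) intervals_in_imp_UNIV [OF that(2)]] HF [OF that(2)] by simp
  qed (use F summable in auto)
  have 3: "\<exists>\<delta>. gauge_on (UNIV - interior G) \<delta> \<and>
      (\<forall>\<pi>. M_partition_in UNIV \<pi> \<and> tagged_in (UNIV - interior G) \<pi> \<and> gauge_fine \<delta> \<pi> \<longrightarrow>
        (\<forall>C\<in>divisions G. (\<forall>(t, I)\<in>\<pi>. overlap_term F C I summable_on UNIV) \<and>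
          norm (\<Sum>(t, I)\<in>\<pi>. \<Sum>k. overlap_term F C I k) < \<epsilon>))" if \<epsilon>: "\<epsilon> > 0" for \<epsilon> :: real
  proof -
    have e: "\<epsilon> / 2 > 0"
      using \<epsilon> by simp
    obtain d where d: "gauge_on UNIV d" and
      SH: "\<forall>\<pi>. M_partition_in UNIV \<pi> \<and> gauge_fine d \<pi> \<longrightarrow>
        norm (\<Sum>(t, I)\<in>\<pi>. measure lebesgue I *\<^sub>R h t - H I) < \<epsilon> / 2"
      using global_Saks_Henstock [OF H int e] by (elim exE conjE)
    have h0: "\<forall>t. t \<notin> G \<longrightarrow> h t = 0"
      using h by simp
    obtain dn where dn: "gauge_on (UNIV - interior G) dn" and
      dn_sum: "\<forall>\<pi>. M_partition_in UNIV \<pi> \<and> tagged_in (UNIV - interior G) \<pi> \<and> gauge_fine dn \<pi> \<longrightarrow>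
        norm (\<Sum>(t, I)\<in>\<pi>. measure lebesgue I *\<^sub>R h t) < \<epsilon> / 2"
      using null_tags_outside_interior [where h = h, OF N h0 e] by (elim exE conjE)
    define \<delta> where "\<delta> t = min (d t) (dn t)" for t
    have "gauge_on (UNIV - interior G) \<delta>"
      using d dn by (auto simp: gauge_on_def \<delta>_def)
    moreover have "(\<forall>(t, I)\<in>\<pi>. overlap_term F C I summable_on UNIV) \<and>
        norm (\<Sum>(t, I)\<in>\<pi>. \<Sum>k. overlap_term F C I k) < \<epsilon>"
      if \<pi>: "M_partition_in UNIV \<pi>" "tagged_in (UNIV - interior G) \<pi>" "gauge_fine \<delta> \<pi>"
        and C: "C \<in> divisions G" for \<pi> C
    proof
      have \<pi>_int: "I \<in> intervals_in UNIV" if "(t, I) \<in> \<pi>" for t I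
        using \<pi>(1) that by (auto simp: M_partition_in_def)
      then show "\<forall>(t, I)\<in>\<pi>. overlap_term F C I summable_on UNIV"
        using summable [OF C] by auto
      have fine: "gauge_fine d \<pi>" "gauge_fine dn \<pi>"
        by (rule gauge_fine_mono [OF \<pi>(3)]; simp add: \<delta>_def)+
      have "(\<Sum>(t, I)\<in>\<pi>. \<Sum>k. overlap_term F C I k) = (\<Sum>(t, I)\<in>\<pi>. H I)"
        using sums_unique [OF sums [OF C]] \<pi>_int by (intro sum.cong) auto
      \<comment> \<open>The first sum is small because the tags avoid the interior, the second is
        the Saks-Henstock error.\<close>
      also have "\<dots> = (\<Sum>(t, I)\<in>\<pi>. measure lebesgue I *\<^sub>R h t) -
          (\<Sum>(t, I)\<in>\<pi>. measure lebesgue I *\<^sub>R h t - H I)"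
        by (simp add: case_prod_unfold sum_subtractf)
      finally have eq: "(\<Sum>(t, I)\<in>\<pi>. \<Sum>k. overlap_term F C I k) = \<dots>" .
      have "norm (\<Sum>(t, I)\<in>\<pi>. measure lebesgue I *\<^sub>R h t - H I) < \<epsilon> / 2"
        using SH \<pi>(1) fine(1) by blast
      moreover have "norm (\<Sum>(t, I)\<in>\<pi>. measure lebesgue I *\<^sub>R h t) < \<epsilon> / 2"
        using dn_sum \<pi>(1,2) fine(2) by blast
      ultimately show "norm (\<Sum>(t, I)\<in>\<pi>. \<Sum>k. overlap_term F C I k) < \<epsilon>"
        unfolding eq by (intro le_less_trans [OF norm_triangle_ineq4]) linarith
    qed
    ultimately show ?thesis
      by blast
  qed
  show ?thesis
    unfolding Hake_McShane_integrable_with_primitive_def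
      M_negligible_variation_outside_interior_def M_negligible_variation_over_def
    using F 1 2 3 by simp
qed

theorem theorem2p8:
  fixes G :: "(real ^ 'm) set"
    and f h :: "real ^ 'm \<Rightarrow> 'x::banach"
    and F :: "(real ^ 'm) set \<Rightarrow> 'x"
  assumes "interior G \<noteq> {}"
    and "G - interior G \<in> null_sets lebesgue"
    and "additive_interval_function G F"
    and "\<And>t. h t = (if t \<in> G then f t else 0)"
  shows "Hake_McShane_integrable_with_primitive f F G \<longleftrightarrow>
    (\<exists>H. locally_McShane_integrable_with_primitive h H UNIV \<and>
         (\<forall>I \<in> intervals_in G. H I = F I) \<and>
         (\<forall>C \<in> divisions G. \<forall>I \<in> intervals_in UNIV. overlap_term F C I sums H I))"
proof
  assume f: "Hake_McShane_integrable_with_primitive f F G"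
  then have Hake: "Hake_function G F"
    by (simp add: Hake_McShane_integrable_with_primitive_def)
  obtain E where E: "E \<in> divisions G"
    "\<And>C x. C \<in> intervals_in UNIV \<Longrightarrow> x \<in> C \<Longrightarrow> x \<in> interior G \<Longrightarrow> \<exists>k. x \<in> E k \<and> interior (C \<inter> E k) \<noteq> {}"
    using whitney_division [OF assms(1)] by blast
  \<comment> \<open>Since the Whitney division can be compared with every other one, the series of
    \<open>F\<close> along any \<open>C\<close> has the same sum.\<close>
  define H where "H I = infsum (overlap_term F E I) UNIV" for I
  have int: "has_McShane_integral h (H I) I" if "I \<in> intervals_in UNIV" for I
    unfolding H_def using Hake_McShane_imp_has_McShane_integral [OF assms(2,4) f E(1) that] .
  have "additive_interval_function UNIV H"
    unfolding H_def using infsum_overlap_term_additive [OF Hake E(1)] .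
  moreover have "McShane_integrable_with_primitive h H J" if "J \<in> intervals_in UNIV" for J
    unfolding McShane_integrable_with_primitive_def McShane_integrable_on_def
    using int that intervals_in_imp_UNIV by blast
  ultimately have "locally_McShane_integrable_with_primitive h H UNIV"
    by (simp add: locally_McShane_integrable_with_primitive_def)
  moreover have "H I = F I" if "I \<in> intervals_in G" for I
    unfolding H_def by (rule Hake_function_infsum [OF Hake E(1) that])
  moreover have "overlap_term F C I sums H I" if C: "C \<in> divisions G" and I: "I \<in> intervals_in UNIV" for C I
    using summable_on_sums_infsum [OF Hake_functionD(1) [OF Hake C I]]
      overlap_infsum_eq [OF Hake C E(1) I assms(1) E(2)] by (simp add: H_def)
  ultimately show "\<exists>H. locally_McShane_integrable_with_primitive h H UNIV \<and>
         (\<forall>I \<in> intervals_in G. H I = F I) \<and>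
         (\<forall>C \<in> divisions G. \<forall>I \<in> intervals_in UNIV. overlap_term F C I sums H I)"
    by blast
next
  assume "\<exists>H. locally_McShane_integrable_with_primitive h H UNIV \<and>
         (\<forall>I \<in> intervals_in G. H I = F I) \<and>
         (\<forall>C \<in> divisions G. \<forall>I \<in> intervals_in UNIV. overlap_term F C I sums H I)"
  then obtain H where H: "locally_McShane_integrable_with_primitive h H UNIV"
    "\<And>I. I \<in> intervals_in G \<Longrightarrow> H I = F I"
    "\<And>C I. C \<in> divisions G \<Longrightarrow> I \<in> intervals_in UNIV \<Longrightarrow> overlap_term F C I sums H I"
    by blast
  have int: "\<forall>K\<in>intervals_in UNIV. has_McShane_integral h (H K) K"
  proof
    fix K :: "(real ^ 'm) set" assume K: "K \<in> intervals_in UNIV"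
    \<comment> \<open>The primitive on \<open>K\<close> is evaluated at the largest subinterval,
      \<open>K\<close> itself.\<close>
    then have "K \<in> intervals_in K"
      using K by (simp add: intervals_in_iff)
    then show "has_McShane_integral h (H K) K"
      using H(1) K unfolding locally_McShane_integrable_with_primitive_def
        McShane_integrable_with_primitive_def by blast
  qed
  have "additive_interval_function UNIV H"
    using H(1) by (simp add: locally_McShane_integrable_with_primitive_def)
  then show "Hake_McShane_integrable_with_primitive f F G"
    by (rule Hake_McShane_integrable_if_locally_McShane [OF assms(2-4) _ int H(2,3)])
qed

end
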